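(* Let $\mathfrak{r}$ be a four-dimensional solvable real Lie algebra which is centerless and non-unimodular. Then the Lie algebra $\mathfrak{g}=\mathfrak{sl}(2,\mathbb{R})\oplus\mathfrak{r}$ (product of Lie algebras) does not have any closed $\mathrm{G}_2$-structure.
   Context: All Lie algebras are real and finite-dimensional; $d$ denotes the Chevalley-Eilenberg differential of $\mathfrak{g}$ (on $1$-forms $d\alpha(x,y)=-\alpha([x,y])$, extended to $\Lambda^*(\mathfrak{g}^* )$ as a graded derivation). A Lie algebra is centerless if its center is $\{0\}$, and unimodular if $\mathrm{tr}(\mathrm{ad}_x)=0$ for all $x$. $\mathrm{G}_2$-structures. Let $\dim\mathfrak{g}=7$. For $\phi\in\Lambda^3(\mathfrak{g}^* )$ let $b_\phi:\mathfrak{g}\times\mathfrak{g}\to\Lambda^7(\mathfrak{g}^* )$ be the symmetric bilinear map $b_\phi(v,w)=\frac16\,\iota_v\phi\wedge\iota_w\phi\wedge\phi$. Its determinant has a well-defined ninth root $\det(b_\phi)^{1/9}\in\Lambda^7(\mathfrak{g}^* )$: if in a basis one writes $b_\phi(e_i,e_j)=B_{ij}\,e^1\wedge\cdots\wedge e^7$, then $\det(b_\phi)^{1/9}=\det(B)^{1/9}e^1\wedge\cdots\wedge e^7$ (real ninth root). The form $\phi$ is stable if $\det(b_\phi)^{1/9}\neq0$ (equivalently, its $\mathrm{GL}(\mathfrak{g})$-orbit is open in $\Lambda^3(\mathfrak{g}^* )$). A $\mathrm{G}_2$-structure on $\mathfrak{g}$ is a stable $3$-form $\varphi$ such that the bilinear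 form $g_\varphi=\det(b_\varphi)^{-1/9}b_\varphi:\mathfrak{g}\times\mathfrak{g}\to\mathbb{R}$ is positive definite. It is closed if $d\varphi=0$. *)

theory Defs
  imports "HOL-Analysis.Analysis" "Jordan_Normal_Form.Determinant"
begin

no_notation Matrix.vec_index (infixl \<open>$\<close> 100)
hide_const (open) Matrix.vec Matrix.mat Determinant.det

section \<open>Lie algebras\<close>

text \<open>A Lie algebra is a real vector space, given as a type, together with a bracket on it.
  Finite-dimensionality is not part of the locale; where it matters the dimension is prescribed.\<close>

locale lie_algebra =
  fixes br :: "'a::real_vector \<Rightarrow> 'a \<Rightarrow> 'a"
  assumes bracket_bilinear: "bilinear br"
    and bracket_self: "br x x = 0"
    and jacobi: "br x (br y z) + br y (br z x) + br z (br x y) = 0"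

definition lie_center :: "('a::real_vector \<Rightarrow> 'a \<Rightarrow> 'a) \<Rightarrow> 'a set" where
  "lie_center br = {z. \<forall>x. br z x = 0}"

primrec derived_series :: "('a::real_vector \<Rightarrow> 'a \<Rightarrow> 'a) \<Rightarrow> nat \<Rightarrow> 'a set" where
  "derived_series br 0 = UNIV"
| "derived_series br (Suc n) = span {br x y | x y. x \<in> derived_series br n \<and> y \<in> derived_series br n}"

definition lie_solvable :: "('a::real_vector \<Rightarrow> 'a \<Rightarrow> 'a) \<Rightarrow> bool" where
  "lie_solvable br \<longleftrightarrow> (\<exists>n. derived_series br n = {0})"

definition ordered_basis :: "'a::real_vector list \<Rightarrow> bool" where
  "ordered_basis e \<longleftrightarrow> distinct e \<and> independent (set e) \<and> span (set e) = UNIV"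

text \<open>An arbitrary fixed ordered basis of a finite-dimensional space. The two notions defined through
  it, the trace of an endomorphism and the quotient of two top-degree forms, do not depend on it.\<close>

definition some_basis :: "'a::real_vector list" where
  "some_basis = (SOME e. ordered_basis e)"

definition endo_trace :: "('a::real_vector \<Rightarrow> 'a) \<Rightarrow> real" where
  "endo_trace f = (\<Sum>b\<in>set some_basis. representation (set some_basis) (f b) b)"

definition lie_unimodular :: "('a::real_vector \<Rightarrow> 'a \<Rightarrow> 'a) \<Rightarrow> bool" where
  "lie_unimodular br \<longleftrightarrow> (\<forall>x. endo_trace (br x) = 0)"

definition prod_bracket ::
  "('a::real_vector \<Rightarrow> 'a \<Rightarrow> 'a) \<Rightarrow> ('b::real_vector \<Rightarrow> 'b \<Rightarrow> 'b) \<Rightarrow> 'a \<times> 'b \<Rightarrow> 'a \<times> 'b \<Rightarrow> 'a \<times> 'b" where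
  "prod_bracket br1 br2 x y = (br1 (fst x) (fst y), br2 (snd x) (snd y))"

lemma some_basis_ordered_basis:
  assumes "dim (UNIV :: 'a::real_vector set) > 0"
  shows "ordered_basis (some_basis :: 'a list)" "length (some_basis :: 'a list) = dim (UNIV :: 'a set)"
proof -
  obtain B :: "'a set" where B: "independent B" "span B = UNIV" "card B = dim (UNIV :: 'a set)"
    by (metis basis_exists top.extremum_uniqueI)
  then have "finite B" using assms card_ge_0_finite by metis
  then obtain e where "set e = B" "distinct e" using finite_distinct_list by blast
  with B have "ordered_basis e" by (simp add: ordered_basis_def)
  then show *: "ordered_basis (some_basis :: 'a list)" unfolding some_basis_def by (rule someI)
  then show "length (some_basis :: 'a list) = dim (UNIV :: 'a set)"
    by (metis ordered_basis_def distinct_card dim_eq_card span_UNIV)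
qed

lemma lie_algebra_prod_bracket:
  assumes "lie_algebra br1" "lie_algebra br2"
  shows "lie_algebra (prod_bracket br1 br2)"
proof -
  interpret a: lie_algebra br1 by fact
  interpret b: lie_algebra br2 by fact
  note bl = a.bracket_bilinear b.bracket_bilinear
  show ?thesis
    by unfold_locales
      (auto simp: prod_bracket_def zero_prod_def bilinear_def linear_iff a.bracket_self b.bracket_self
        a.jacobi b.jacobi bl[THEN bilinear_ladd] bl[THEN bilinear_radd] bl[THEN bilinear_lmul]
        bl[THEN bilinear_rmul])
qed


section \<open>The Lie algebra of traceless real two-by-two matrices\<close>

typedef sl2 = "{A :: real^2^2. trace A = 0}"
  by (rule exI[of _ 0]) (simp add: trace_def)

setup_lifting type_definition_sl2

instantiation sl2 :: real_vector
begin

lift_definition zero_sl2 :: sl2 is 0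
  by (simp add: trace_def)

lift_definition plus_sl2 :: "sl2 \<Rightarrow> sl2 \<Rightarrow> sl2" is "(+)"
  by (simp add: trace_add)

lift_definition minus_sl2 :: "sl2 \<Rightarrow> sl2 \<Rightarrow> sl2" is "(-)"
  by (simp add: trace_sub)

lift_definition uminus_sl2 :: "sl2 \<Rightarrow> sl2" is uminus
  by (simp add: trace_def sum_negf)

lift_definition scaleR_sl2 :: "real \<Rightarrow> sl2 \<Rightarrow> sl2" is "(*\<^sub>R)"
  by (simp add: trace_def flip: sum_distrib_left)

instance
  by standard (transfer; simp add: algebra_simps)+

end

lift_definition sl2_bracket :: "sl2 \<Rightarrow> sl2 \<Rightarrow> sl2" is "\<lambda>A B. A ** B - B ** A"
  by (metis trace_sub trace_mul_sym diff_self)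

lemma lie_algebra_sl2_bracket: "lie_algebra sl2_bracket"
proof
  have add_r: "(B + C) ** A = B ** A + C ** A" and sub_r: "(B - C) ** A = B ** A - C ** A"
    and sub_l: "A ** (B - C) = A ** B - A ** C" for A B C :: "real^2^2"
    by (simp_all add: matrix_matrix_mult_def Finite_Cartesian_Product.vec_eq_iff distrib_left distrib_right
        left_diff_distrib right_diff_distrib sum.distrib sum_subtractf)
  show "bilinear sl2_bracket"
    unfolding bilinear_def linear_iff
    by (safe; transfer)
      (simp_all add: matrix_add_ldistrib add_r matrix_scalar_ac scaleR_right_diff_distrib
        flip: scalar_matrix_assoc)
  show "sl2_bracket x x = 0" for x
    by transfer simp
  show "sl2_bracket x (sl2_bracket y z) + sl2_bracket y (sl2_bracket z x)
      + sl2_bracket z (sl2_bracket x y) = 0" for x y z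
    by transfer (simp add: sub_l sub_r matrix_mul_assoc)
qed


section \<open>Exterior forms\<close>

text \<open>A form is a real-valued function on lists of vectors. The list is the tuple of arguments, and a
  \<open>k\<close>-form vanishes by convention on lists of length other than \<open>k\<close>, so that equality of forms
  is equality of functions.\<close>

definition is_form :: "nat \<Rightarrow> ('a::real_vector list \<Rightarrow> real) \<Rightarrow> bool" where
  "is_form k \<omega> \<longleftrightarrow>
     (\<forall>vs. length vs \<noteq> k \<longrightarrow> \<omega> vs = 0) \<and>
     (\<forall>us ws. linear (\<lambda>x. \<omega> (us @ x # ws))) \<and>
     (\<forall>vs. \<not> distinct vs \<longrightarrow> \<omega> vs = 0)"

definition contract :: "'a \<Rightarrow> ('a list \<Rightarrow> real) \<Rightarrow> 'a list \<Rightarrow> real" where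
  "contract v \<omega> = (\<lambda>vs. \<omega> (v # vs))"

text \<open>For a \<open>p\<close>-form and a \<open>q\<close>-form this is the usual sum over \<open>(p,q)\<close>-shuffles: \<open>S\<close> is the set of
  positions fed to the first factor, the sign is that of the shuffle, and only sets \<open>S\<close> of
  cardinality \<open>p\<close> contribute. The wedge of a dual basis takes the value 1 on the basis.\<close>

definition shuffle_sign :: "nat \<Rightarrow> nat set \<Rightarrow> real" where
  "shuffle_sign n S = (- 1) ^ card {(i, j). i < j \<and> j < n \<and> i \<notin> S \<and> j \<in> S}"

definition wedge :: "('a list \<Rightarrow> real) \<Rightarrow> ('a list \<Rightarrow> real) \<Rightarrow> 'a list \<Rightarrow> real" where
  "wedge \<alpha> \<beta> = (\<lambda>vs. \<Sum>S\<in>Pow {..<length vs}.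
     shuffle_sign (length vs) S * \<alpha> (nths vs S) * \<beta> (nths vs (- S)))"

text \<open>The Chevalley--Eilenberg differential, by its usual invariant formula. The lemmas
  \<open>CE_d_one_form\<close> and \<open>CE_d_wedge\<close> below identify it as the graded derivation extending
  \<open>d\<alpha>(x,y) = -\<alpha>([x,y])\<close>.\<close>

definition CE_d :: "('a \<Rightarrow> 'a \<Rightarrow> 'a) \<Rightarrow> ('a list \<Rightarrow> real) \<Rightarrow> 'a list \<Rightarrow> real" where
  "CE_d br \<omega> = (\<lambda>vs. \<Sum>j<length vs. \<Sum>i<j.
     (- 1) ^ (i + j) * \<omega> (br (vs ! i) (vs ! j) # nths vs (- {i, j})))"

definition closed_form :: "('a \<Rightarrow> 'a \<Rightarrow> 'a) \<Rightarrow> ('a list \<Rightarrow> real) \<Rightarrow> bool" where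
  "closed_form br \<omega> \<longleftrightarrow> CE_d br \<omega> = (\<lambda>_. 0)"

lemma CE_d_one_form: "CE_d br \<alpha> [x, y] = - \<alpha> [br x y]"
  by (simp add: CE_d_def nths_Cons lessThan_Suc)


subsection \<open>The differential is a graded derivation\<close>

definition antisym_form :: "('a list \<Rightarrow> real) \<Rightarrow> bool" where
  "antisym_form \<omega> \<longleftrightarrow> (\<forall>us v w ws. \<omega> (us @ v # w # ws) = - \<omega> (us @ w # v # ws))"

definition hat :: "('a list \<Rightarrow> real) \<Rightarrow> 'a list \<Rightarrow> real" where
  "hat \<omega> = (\<lambda>vs. (- 1) ^ length vs * \<omega> vs)"

definition lie_deriv :: "('a \<Rightarrow> 'a \<Rightarrow> 'a) \<Rightarrow> 'a \<Rightarrow> ('a list \<Rightarrow> real) \<Rightarrow> 'a list \<Rightarrow> real" where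
  "lie_deriv br v \<omega> = (\<lambda>vs. - (\<Sum>j<length vs. \<omega> (vs[j := br v (vs ! j)])))"

lemma is_form_antisym:
  assumes "is_form k \<omega>"
  shows "antisym_form \<omega>"
  unfolding antisym_form_def
proof (intro allI)
  fix us v w ws
  have lin: "\<And>us ws. linear (\<lambda>x. \<omega> (us @ x # ws))" and z: "\<And>vs. \<not> distinct vs \<Longrightarrow> \<omega> vs = 0"
    using assms by (auto simp: is_form_def)
  have 1: "\<omega> (us @ (x + y) # u # ws) = \<omega> (us @ x # u # ws) + \<omega> (us @ y # u # ws)" for x y u
    using linear_add[OF lin[of us "u # ws"]] by simp
  have 2: "\<omega> (us @ u # (x + y) # ws) = \<omega> (us @ u # x # ws) + \<omega> (us @ u # y # ws)" for x y u
    using linear_add[OF lin[of "us @ [u]" ws]] by simp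
  have "\<omega> (us @ (v + w) # (v + w) # ws) = 0" by (rule z) simp
  moreover have "\<omega> (us @ v # v # ws) = 0" "\<omega> (us @ w # w # ws) = 0" by (rule z, simp)+
  ultimately show "\<omega> (us @ v # w # ws) = - \<omega> (us @ w # v # ws)"
    unfolding 1 2 by simp
qed

lemma antisym_formD: "antisym_form \<omega> \<Longrightarrow> \<omega> (us @ v # w # ws) = - \<omega> (us @ w # v # ws)"
  unfolding antisym_form_def by blast

lemma antisym_contract: "antisym_form \<omega> \<Longrightarrow> antisym_form (contract v \<omega>)"
  unfolding antisym_form_def contract_def by (metis append_Cons)

lemma antisym_hat: "antisym_form \<omega> \<Longrightarrow> antisym_form (hat \<omega>)"
proof -
  assume a: "antisym_form \<omega>"
  have "hat \<omega> (us @ v # w # ws) = - hat \<omega> (us @ w # v # ws)" for us v w ws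
    by (simp add: hat_def antisym_formD[OF a, of us v w ws])
  then show ?thesis unfolding antisym_form_def by blast
qed

lemma shuffle_sign_Suc_insert: "shuffle_sign (Suc n) (insert 0 (Suc ` T)) = shuffle_sign n T"
proof -
  have "{(i, j). i < j \<and> j < Suc n \<and> i \<notin> insert 0 (Suc ` T) \<and> j \<in> insert 0 (Suc ` T)}
      = map_prod Suc Suc ` {(i, j). i < j \<and> j < n \<and> i \<notin> T \<and> j \<in> T}" (is "?L = ?R")
  proof (rule Set.set_eqI)
    fix p :: "nat \<times> nat"
    obtain i j where p: "p = (i, j)" by fastforce
    show "p \<in> ?L \<longleftrightarrow> p \<in> ?R"
      unfolding p by (cases i; cases j) (auto simp: image_iff)
  qed
  then show ?thesis
    by (simp add: shuffle_sign_def card_image inj_on_def map_prod_def split_beta prod_eq_iff)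
qed

lemma shuffle_sign_Suc:
  assumes "T \<subseteq> {..<n}"
  shows "shuffle_sign (Suc n) (Suc ` T) = (- 1) ^ card T * shuffle_sign n T"
proof -
  let ?A = "{(i, j). i < j \<and> j < n \<and> i \<notin> T \<and> j \<in> T}"
  have "{(i, j). i < j \<and> j < Suc n \<and> i \<notin> Suc ` T \<and> j \<in> Suc ` T}
      = (\<lambda>j. (0, Suc j)) ` T \<union> map_prod Suc Suc ` ?A" (is "?L = ?R")
  proof (rule Set.set_eqI)
    fix p :: "nat \<times> nat"
    obtain i j where p: "p = (i, j)" by fastforce
    show "p \<in> ?L \<longleftrightarrow> p \<in> ?R"
      unfolding p using assms by (cases i; cases j) (auto simp: image_iff)
  qed
  moreover have "card ((\<lambda>j. (0 :: nat, Suc j)) ` T \<union> map_prod Suc Suc ` ?A) = card T + card ?A"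
  proof -
    have "finite T" using assms finite_subset by blast
    moreover have "finite ?A" by (rule finite_subset[of _ "{..<n} \<times> {..<n}"]) auto
    moreover have "(\<lambda>j. (0 :: nat, Suc j)) ` T \<inter> map_prod Suc Suc ` ?A = {}" by auto
    moreover have "card ((\<lambda>j. (0 :: nat, Suc j)) ` T) = card T"
      by (rule card_image) (simp add: inj_on_def)
    moreover have "card (map_prod Suc Suc ` ?A) = card ?A"
      by (rule card_image) (simp add: inj_on_def map_prod_def split_beta prod_eq_iff)
    ultimately show ?thesis by (simp add: card_Un_disjoint)
  qed
  ultimately have "card {(i, j). i < j \<and> j < Suc n \<and> i \<notin> Suc ` T \<and> j \<in> Suc ` T} = card T + card ?A"
    by simp
  then show ?thesis by (simp add: shuffle_sign_def power_add)
qed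

lemma wedge_Nil: "wedge \<alpha> \<beta> [] = \<alpha> [] * \<beta> []"
  by (simp add: wedge_def shuffle_sign_def)

lemma wedge_Cons:
  "wedge \<alpha> \<beta> (v # vs) = wedge (contract v \<alpha>) \<beta> vs + wedge (hat \<alpha>) (contract v \<beta>) vs"
proof -
  let ?n = "length vs"
  let ?f = "\<lambda>S. shuffle_sign (Suc ?n) S * \<alpha> (nths (v # vs) S) * \<beta> (nths (v # vs) (- S))"
  have P: "Pow {..<Suc ?n} = (\<lambda>T. insert 0 (Suc ` T)) ` Pow {..<?n} \<union> (`) Suc ` Pow {..<?n}"
    unfolding lessThan_Suc_eq_insert_0 Pow_insert image_Pow_surj[OF refl, symmetric]
    by (auto simp: image_image)
  have inj1: "inj_on (\<lambda>T. insert 0 (Suc ` T)) (Pow {..<?n})"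
    by (rule inj_onI) (metis Suc_neq_Zero imageE inj_Suc inj_image_eq_iff insert_ident)
  have inj2: "inj_on ((`) Suc) (Pow {..<?n})"
    by (rule inj_onI) (metis inj_Suc inj_image_eq_iff)
  have disj: "(\<lambda>T. insert 0 (Suc ` T)) ` Pow {..<?n} \<inter> (`) Suc ` Pow {..<?n} = {}"
    by auto
  have "wedge \<alpha> \<beta> (v # vs) = (\<Sum>T\<in>Pow {..<?n}. ?f (insert 0 (Suc ` T))) + (\<Sum>T\<in>Pow {..<?n}. ?f (Suc ` T))"
    unfolding wedge_def length_Cons P
    by (subst sum.union_disjoint[OF _ _ disj])
       (simp_all add: sum.reindex[OF inj1] sum.reindex[OF inj2])
  also have "(\<Sum>T\<in>Pow {..<?n}. ?f (insert 0 (Suc ` T))) = wedge (contract v \<alpha>) \<beta> vs"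
  proof -
    have "{j. Suc j \<in> insert 0 (Suc ` T)} = T" "{j. Suc j \<in> - insert 0 (Suc ` T)} = - T" for T
      by auto
    then show ?thesis
      by (simp add: wedge_def nths_Cons shuffle_sign_Suc_insert contract_def)
  qed
  also have "(\<Sum>T\<in>Pow {..<?n}. ?f (Suc ` T)) = wedge (hat \<alpha>) (contract v \<beta>) vs"
    unfolding wedge_def
  proof (rule sum.cong[OF refl])
    fix T assume T: "T \<in> Pow {..<?n}"
    have e: "{j. Suc j \<in> Suc ` T} = T" "{j. Suc j \<in> - Suc ` T} = - T" by auto
    have "{i. i < ?n \<and> i \<in> T} = T" using T by auto
    then have "length (nths vs T) = card T" by (simp add: length_nths)
    with T e show "?f (Suc ` T) = shuffle_sign ?n T * hat \<alpha> (nths vs T) * contract v \<beta> (nths vs (- T))"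
      by (simp add: nths_Cons shuffle_sign_Suc contract_def hat_def image_iff)
  qed
  finally show ?thesis .
qed

lemma wedge_linear:
  "wedge (\<lambda>us. - \<alpha> us) \<beta> vs = - wedge \<alpha> \<beta> vs"
  "wedge \<alpha> (\<lambda>us. - \<beta> us) vs = - wedge \<alpha> \<beta> vs"
  "wedge (\<lambda>us. \<alpha> us + \<alpha>' us) \<beta> vs = wedge \<alpha> \<beta> vs + wedge \<alpha>' \<beta> vs"
  "wedge \<alpha> (\<lambda>us. \<beta> us + \<beta>' us) vs = wedge \<alpha> \<beta> vs + wedge \<alpha> \<beta>' vs"
  "wedge (\<lambda>us. \<alpha> us - \<alpha>' us) \<beta> vs = wedge \<alpha> \<beta> vs - wedge \<alpha>' \<beta> vs"
  "wedge \<alpha> (\<lambda>us. \<beta> us - \<beta>' us) vs = wedge \<alpha> \<beta> vs - wedge \<alpha> \<beta>' vs"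
  "wedge (\<lambda>us. c * \<alpha> us) \<beta> vs = c * wedge \<alpha> \<beta> vs"
  by (simp_all add: wedge_def sum_negf algebra_simps sum.distrib sum_subtractf sum_distrib_left)

lemma contract_simps:
  "contract v (\<lambda>us. - \<alpha> us) = (\<lambda>us. - contract v \<alpha> us)"
  "contract v (hat \<alpha>) = (\<lambda>us. - hat (contract v \<alpha>) us)"
  by (simp_all add: contract_def hat_def)

lemma hat_hat: "hat (hat \<alpha>) = \<alpha>"
  by (simp add: hat_def flip: power_add mult.assoc)

lemma wedge_antisym:
  assumes "antisym_form \<alpha>" "antisym_form \<beta>"
  shows "antisym_form (wedge \<alpha> \<beta>)"
proof -
  have sw: "contract v (contract w \<omega>) = (\<lambda>us. - contract w (contract v \<omega>) us)"
    if "antisym_form \<omega>" for \<omega> :: "'a list \<Rightarrow> real" and v w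
    using that unfolding antisym_form_def contract_def by (metis append_Nil)
  have "wedge \<alpha> \<beta> (us @ v # w # ws) = - wedge \<alpha> \<beta> (us @ w # v # ws)" for us v w ws
    using assms
  proof (induction us arbitrary: \<alpha> \<beta>)
    case Nil
    then show ?case
      using sw[OF Nil(1), of v w] sw[OF Nil(2), of v w]
      by (simp add: wedge_Cons contract_simps hat_hat wedge_linear)
  next
    case (Cons u us)
    then show ?case
      by (simp add: wedge_Cons antisym_contract antisym_hat)
  qed
  then show ?thesis unfolding antisym_form_def by blast
qed

lemma lie_deriv_Cons:
  "lie_deriv br v \<omega> (u # us) = - \<omega> (br v u # us) + lie_deriv br v (contract u \<omega>) us"
  by (simp add: lie_deriv_def contract_def sum.lessThan_Suc_shift del: sum.lessThan_Suc)

lemma contract_lie_deriv: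
  "contract u (lie_deriv br v \<omega>) =
    (\<lambda>us. - contract (br v u) \<omega> us + lie_deriv br v (contract u \<omega>) us)"
  by (rule ext) (simp add: contract_def[of u "lie_deriv br v \<omega>"] lie_deriv_Cons contract_def[of "br v u"])

lemma hat_lie_deriv: "hat (lie_deriv br v \<omega>) = lie_deriv br v (hat \<omega>)"
  by (simp add: hat_def lie_deriv_def sum_distrib_left)

lemma lie_deriv_add:
  "lie_deriv br v (\<lambda>us. \<alpha> us + \<beta> us) vs = lie_deriv br v \<alpha> vs + lie_deriv br v \<beta> vs"
  by (simp add: lie_deriv_def sum.distrib)

lemma lie_deriv_wedge:
  "lie_deriv br v (wedge \<alpha> \<beta>) vs = wedge (lie_deriv br v \<alpha>) \<beta> vs + wedge \<alpha> (lie_deriv br v \<beta>) vs"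
proof (induction vs arbitrary: \<alpha> \<beta>)
  case Nil
  then show ?case by (simp add: wedge_Nil) (simp add: lie_deriv_def)
next
  case (Cons u vs)
  have "contract u (wedge \<alpha> \<beta>) = (\<lambda>us. wedge (contract u \<alpha>) \<beta> us + wedge (hat \<alpha>) (contract u \<beta>) us)"
    by (simp add: contract_def[of u "wedge \<alpha> \<beta>"] wedge_Cons)
  then show ?case
    by (simp add: lie_deriv_Cons lie_deriv_add Cons.IH wedge_Cons contract_lie_deriv hat_lie_deriv
        wedge_linear)
qed

lemma antisym_move_front:
  assumes "antisym_form \<omega>"
  shows "\<omega> (x # us @ ws) = (- 1) ^ length us * \<omega> (us @ x # ws)"
proof -
  have "\<omega> (ps @ x # us @ ws) = (- 1) ^ length us * \<omega> (ps @ us @ x # ws)" for ps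
  proof (induction us arbitrary: ps)
    case (Cons u us)
    have "\<omega> (ps @ x # (u # us) @ ws) = - \<omega> ((ps @ [u]) @ x # us @ ws)"
      using antisym_formD[OF assms, of ps x u "us @ ws"] by simp
    also have "\<dots> = (- 1) ^ length (u # us) * \<omega> (ps @ (u # us) @ x # ws)"
      by (subst Cons.IH) simp
    finally show ?case .
  qed simp
  from this[of "[]"] show ?thesis by simp
qed

lemma nths_Compl_singleton: "nths vs (- {j}) = take j vs @ drop (Suc j) vs"
proof (induction vs arbitrary: j)
  case (Cons v vs)
  have "{i. Suc i \<noteq> j} = (case j of 0 \<Rightarrow> UNIV | Suc k \<Rightarrow> - {k})" by (cases j) auto
  with Cons.IH show ?case by (cases j) (auto simp: nths_Cons nths_all)
qed simp

lemma CE_d_Cons: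
  assumes "antisym_form \<omega>"
  shows "CE_d br \<omega> (v # vs) = lie_deriv br v \<omega> vs - CE_d br (contract v \<omega>) vs"
proof -
  have e: "- {j} = {i. i \<noteq> j}" "- {i, j} = {k. k \<noteq> i \<and> k \<noteq> j}" for i j :: nat
    by auto
  have "CE_d br \<omega> (v # vs) =
    (\<Sum>j<length vs. (- 1) ^ Suc j * \<omega> (br v (vs ! j) # nths vs (- {j}))
       + (\<Sum>i<j. (- 1) ^ (i + j) * \<omega> (br (vs ! i) (vs ! j) # v # nths vs (- {i, j}))))"
    by (simp add: CE_d_def sum.lessThan_Suc_shift nths_Cons e del: sum.lessThan_Suc)
  also have "\<dots> = (\<Sum>j<length vs. - \<omega> (vs[j := br v (vs ! j)])
       - (\<Sum>i<j. (- 1) ^ (i + j) * contract v \<omega> (br (vs ! i) (vs ! j) # nths vs (- {i, j}))))"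
  proof (rule sum.cong[OF refl])
    fix j assume "j \<in> {..<length vs}"
    then have j: "j < length vs" by simp
    have 1: "(- 1) ^ Suc j * \<omega> (br v (vs ! j) # nths vs (- {j})) = - \<omega> (vs[j := br v (vs ! j)])"
      using j unfolding nths_Compl_singleton
      by (subst antisym_move_front[OF assms])
         (simp add: upd_conv_take_nth_drop min_def flip: power_add mult.assoc)
    have 2: "\<omega> (br (vs ! i) (vs ! j) # v # ws) = - contract v \<omega> (br (vs ! i) (vs ! j) # ws)" for i ws
      using assms unfolding antisym_form_def contract_def by (metis append_Nil)
    show "(- 1) ^ Suc j * \<omega> (br v (vs ! j) # nths vs (- {j}))
       + (\<Sum>i<j. (- 1) ^ (i + j) * \<omega> (br (vs ! i) (vs ! j) # v # nths vs (- {i, j})))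
       = - \<omega> (vs[j := br v (vs ! j)])
       - (\<Sum>i<j. (- 1) ^ (i + j) * contract v \<omega> (br (vs ! i) (vs ! j) # nths vs (- {i, j})))"
      unfolding 1 2 by (simp add: sum_negf)
  qed
  also have "\<dots> = lie_deriv br v \<omega> vs - CE_d br (contract v \<omega>) vs"
    by (simp add: lie_deriv_def CE_d_def sum_subtractf sum_negf)
  finally show ?thesis .
qed

lemma CE_d_linear:
  "CE_d br (\<lambda>us. \<alpha> us + \<beta> us) vs = CE_d br \<alpha> vs + CE_d br \<beta> vs"
  "CE_d br (\<lambda>us. - \<alpha> us) vs = - CE_d br \<alpha> vs"
  "CE_d br (\<lambda>us. c * \<alpha> us) vs = c * CE_d br \<alpha> vs"
  by (simp_all add: CE_d_def sum.distrib sum_negf sum_distrib_left algebra_simps)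

lemma hat_CE_d: "hat (CE_d br \<omega>) = (\<lambda>vs. - CE_d br (hat \<omega>) vs)"
proof (rule ext)
  fix vs :: "'a list"
  have l: "length (nths vs (- {i, j})) + 2 = length vs" if "i < j" "j < length vs" for i j
  proof -
    have "{k. k < length vs \<and> k \<in> - {i, j}} = {..<length vs} - {i, j}" by auto
    with that show ?thesis by (simp add: length_nths card_Diff_subset)
  qed
  have s: "(- 1 :: real) ^ length vs = - ((- 1) ^ Suc (length (nths vs (- {i, j}))))"
    if "i < j" "j < length vs" for i j
    by (simp flip: l[OF that])
  show "hat (CE_d br \<omega>) vs = - CE_d br (hat \<omega>) vs"
    unfolding hat_def CE_d_def sum_distrib_left sum_negf[symmetric]
    by (intro sum.cong refl) (simp add: s)
qed

lemma CE_d_wedge_hat: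
  assumes "antisym_form \<alpha>" "antisym_form \<beta>"
  shows "CE_d br (wedge \<alpha> \<beta>) vs = wedge (CE_d br \<alpha>) \<beta> vs + wedge (hat \<alpha>) (CE_d br \<beta>) vs"
  using assms
proof (induction vs arbitrary: \<alpha> \<beta>)
  case Nil
  then show ?case by (simp add: wedge_Nil) (simp add: CE_d_def)
next
  case (Cons v vs)
  have c: "contract v (wedge \<alpha> \<beta>) = (\<lambda>us. wedge (contract v \<alpha>) \<beta> us + wedge (hat \<alpha>) (contract v \<beta>) us)"
    by (simp add: contract_def[of v "wedge \<alpha> \<beta>"] wedge_Cons)
  have d: "contract v (CE_d br \<omega>) = (\<lambda>us. lie_deriv br v \<omega> us - CE_d br (contract v \<omega>) us)"
    if "antisym_form \<omega>" for \<omega>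
    using that by (simp add: contract_def[of v "CE_d br \<omega>"] CE_d_Cons)
  have "CE_d br (wedge \<alpha> \<beta>) (v # vs) =
      wedge (lie_deriv br v \<alpha>) \<beta> vs + wedge \<alpha> (lie_deriv br v \<beta>) vs
      - (wedge (CE_d br (contract v \<alpha>)) \<beta> vs + wedge (hat (contract v \<alpha>)) (CE_d br \<beta>) vs
        + wedge (CE_d br (hat \<alpha>)) (contract v \<beta>) vs + wedge \<alpha> (CE_d br (contract v \<beta>)) vs)"
    using Cons.prems
    by (simp add: CE_d_Cons wedge_antisym lie_deriv_wedge c CE_d_linear Cons.IH antisym_contract
        antisym_hat hat_hat)
  then show ?case
    using Cons.prems
    by (simp add: wedge_Cons d hat_CE_d contract_simps hat_hat wedge_linear)
qed

lemma CE_d_wedge: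
  assumes "is_form p \<alpha>" "is_form q \<beta>"
  shows "CE_d br (wedge \<alpha> \<beta>) =
    (\<lambda>vs. wedge (CE_d br \<alpha>) \<beta> vs + (- 1) ^ p * wedge \<alpha> (CE_d br \<beta>) vs)"
proof -
  have "hat \<alpha> = (\<lambda>us. (- 1) ^ p * \<alpha> us)"
    using assms(1) by (auto simp: hat_def is_form_def fun_eq_iff)
  then show ?thesis
    by (intro ext) (simp add: CE_d_wedge_hat[OF assms[THEN is_form_antisym]] wedge_linear)
qed


section \<open>\<open>G\<^sub>2\<close>-structures\<close>

text \<open>The definitions below are meant for a seven-dimensional space.\<close>

definition b_form ::
  "('a list \<Rightarrow> real) \<Rightarrow> 'a \<Rightarrow> 'a \<Rightarrow> 'a list \<Rightarrow> real" where
  "b_form \<phi> v w = (\<lambda>vs. 1 / 6 * wedge (wedge (contract v \<phi>) (contract w \<phi>)) \<phi> vs)"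

text \<open>For a basis \<open>e\<close>, the number \<open>b e\<^sub>i e\<^sub>j e\<close> is the coefficient of \<open>b e\<^sub>i e\<^sub>j\<close> with respect to
  \<open>e\<^sup>1 \<and> \<dots> \<and> e\<^sup>7\<close>, and the value of the seven-form \<open>det(b)\<^bsup>1/9\<^esup>\<close> on \<open>e\<close> is the ninth root of the
  determinant of the matrix of these coefficients. If the arguments are linearly dependent the
  matrix is zero, as is the form.\<close>

definition det_ninth_root :: "('a \<Rightarrow> 'a \<Rightarrow> 'a list \<Rightarrow> real) \<Rightarrow> 'a list \<Rightarrow> real" where
  "det_ninth_root b = (\<lambda>e. if length e = 7
     then root 9 (Determinant.det (Matrix.mat 7 7 (\<lambda>(i, j). b (e ! i) (e ! j) e))) else 0)"

definition stable_form :: "('a::real_vector list \<Rightarrow> real) \<Rightarrow> bool" where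
  "stable_form \<phi> \<longleftrightarrow> is_form 3 \<phi> \<and> det_ninth_root (b_form \<phi>) \<noteq> (\<lambda>_. 0)"

text \<open>The quotient of two seven-forms is computed on a basis.\<close>

definition g_metric :: "('a::real_vector list \<Rightarrow> real) \<Rightarrow> 'a \<Rightarrow> 'a \<Rightarrow> real" where
  "g_metric \<phi> v w = b_form \<phi> v w some_basis / det_ninth_root (b_form \<phi>) some_basis"

definition G2_structure :: "('a::real_vector list \<Rightarrow> real) \<Rightarrow> bool" where
  "G2_structure \<phi> \<longleftrightarrow> stable_form \<phi> \<and> (\<forall>v. v \<noteq> 0 \<longrightarrow> g_metric \<phi> v v > 0)"

end

theory Submission
  imports Defs
begin

text \<open>A \<open>G\<^sub>2\<close>-structure \<open>\<phi>\<close> is nondegenerate: for \<open>x \<noteq> 0\<close> the kernel of the two-form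
  \<open>\<iota>\<^sub>x\<phi>\<close> is the line through \<open>x\<close>. Indeed \<open>\<iota>\<^sub>x(b\<^sub>\<phi>(x,x))\<close> is \<open>1/6\<close> times the cube of \<open>\<iota>\<^sub>x\<phi>\<close>, so a
  larger kernel forces \<open>b\<^sub>\<phi>(x,x) = 0\<close> (\<open>G2_structure_nondegenerate\<close>). The proof exhibits, for a
  closed \<open>\<phi>\<close>, a violation of this single property.

  Closedness on two vectors \<open>a\<close>, \<open>b\<close> of \<open>sl(2)\<close> and two vectors \<open>y\<close>, \<open>z\<close> of \<open>r\<close> reads
  \<open>\<phi>([a,b],y,z) = -\<phi>([y,z],a,b)\<close>. As \<open>sl(2)\<close> is perfect, the component of \<open>\<phi>\<close> with one argument in
  \<open>sl(2)\<close> and two in \<open>r\<close> is therefore determined by the map \<open>B\<close> from \<open>r\<close> to the two-forms on \<open>sl(2)\<close>,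
  \<open>B(y)(a,b) = \<phi>(y,a,b)\<close>. Its target is three-dimensional, so \<open>B(v) = 0\<close> for some \<open>v \<noteq> 0\<close>.
  Nondegeneracy at \<open>v\<close>, tested against vectors of \<open>sl(2)\<close>, says that \<open>z \<mapsto> B[v,z]\<close> is onto. Hence
  the image \<open>n\<close> of \<open>ad v\<close> is a three-dimensional complement of \<open>v\<close>; solvability identifies \<open>n\<close> with
  \<open>[r,r]\<close>, and \<open>ad v\<close> acts invertibly on it.

  A solvable three-dimensional \<open>n\<close> with such a derivation is abelian or a Heisenberg algebra: it has a
  basis \<open>x\<close>, \<open>p\<close>, \<open>q\<close> with \<open>x\<close> central and \<open>[p,q]\<close> a multiple of \<open>x\<close> (\<open>derived_algebra_basis\<close>). The
  elements of \<open>n\<close> then have traceless adjoint operators on \<open>r\<close>, so non-unimodularity means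
  \<open>tr(ad v) \<noteq> 0\<close>; since \<open>d\<phi>(v,x,p,q)\<close> is \<open>-tr(ad v) \<phi>(x,p,q)\<close>, the form \<open>\<phi>\<close> vanishes on \<open>n\<close>.

  Finally choose \<open>y \<noteq> 0\<close> in the plane of \<open>p\<close> and \<open>q\<close> with \<open>\<phi>(x,y,v) = 0\<close>. Then \<open>\<phi>(x,y,-)\<close> vanishes on \<open>v\<close>,
  on \<open>n\<close>, and also on \<open>sl(2)\<close>, where it is governed by \<open>[x,y] = 0\<close>. So \<open>y\<close> lies in the kernel of
  \<open>\<iota>\<^sub>x\<phi>\<close> without being a multiple of \<open>x\<close>.\<close>

section \<open>Bases, dimensions and traces\<close>

lemma in_span_2: "y \<in> span {p, q} \<longleftrightarrow> (\<exists>a b. y = a *\<^sub>R p + b *\<^sub>R q)"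
  unfolding span_breakdown_eq[of y p] span_singleton
  by (auto simp: diff_eq_eq add.commute image_iff)

lemma in_span_3: "y \<in> span {p, q, r} \<longleftrightarrow> (\<exists>a b c. y = a *\<^sub>R p + b *\<^sub>R q + c *\<^sub>R r)"
  unfolding span_breakdown_eq[of y p] in_span_2
  by (auto simp: diff_eq_eq algebra_simps)

lemma independent_2_coeffs:
  assumes "independent {p, q}" "p \<noteq> q" "a *\<^sub>R p + b *\<^sub>R q = a' *\<^sub>R p + b' *\<^sub>R q"
  shows "a = a' \<and> b = b'"
proof -
  define u where "u y = (if y = p then a - a' else b - b')" for y
  have "(\<Sum>y\<in>{p, q}. u y *\<^sub>R y) = 0" using assms(2,3) by (auto simp: u_def algebra_simps)
  moreover have "\<nexists>u. (\<exists>y\<in>{p, q}. u y \<noteq> 0) \<and> (\<Sum>y\<in>{p, q}. u y *\<^sub>R y) = 0"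
    using assms(1) real_vector.dependent_finite[of "{p, q}"] by simp
  ultimately have "u p = 0 \<and> u q = 0" by blast
  with assms(2) show ?thesis by (simp add: u_def)
qed

lemma dim_UNIV_pos_basis:
  assumes "dim (UNIV :: 'a::real_vector set) > 0"
  obtains B :: "'a::real_vector set" where "finite B" "independent B" "span B = UNIV" "card B = dim (UNIV :: 'a set)"
proof -
  obtain B :: "'a set" where "independent B" "span B = UNIV" "card B = dim (UNIV :: 'a set)"
    by (metis basis_exists top.extremum_uniqueI)
  then show thesis using that assms card_ge_0_finite by metis
qed

lemma dim_prod:
  assumes "dim (UNIV :: 'a::real_vector set) > 0" "dim (UNIV :: 'b::real_vector set) > 0"
  shows "dim (UNIV :: ('a \<times> 'b) set) = dim (UNIV :: 'a set) + dim (UNIV :: 'b set)"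
proof -
  obtain A :: "'a set" where A: "finite A" "independent A" "span A = UNIV" "card A = dim (UNIV :: 'a set)"
    using assms(1) by (rule dim_UNIV_pos_basis)
  obtain B :: "'b set" where B: "finite B" "independent B" "span B = UNIV" "card B = dim (UNIV :: 'b set)"
    using assms(2) by (rule dim_UNIV_pos_basis)
  interpret P: finite_dimensional_vector_space_prod
    "scaleR :: real \<Rightarrow> 'a \<Rightarrow> 'a" "scaleR :: real \<Rightarrow> 'b \<Rightarrow> 'b" A B
    using A B by unfold_locales (auto simp: dependent_raw_def span_raw_def)
  show ?thesis
    using P.dim_Times[OF real_vector.subspace_UNIV[unfolded subspace_raw_def]
        real_vector.subspace_UNIV[unfolded subspace_raw_def]]
    unfolding module_prod_scale_eq_scaleR dim_raw_def by simp
qed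

lemma independent_card_dim_spans:
  assumes "independent S" "card S = dim (UNIV :: 'a::real_vector set)" "dim (UNIV :: 'a set) > 0"
  shows "span (S :: 'a set) = UNIV"
proof -
  obtain C where C: "S \<subseteq> C" "independent C" "span C = UNIV"
    by (rule real_vector.maximal_independent_subset_extend[OF subset_UNIV assms(1)]) auto
  then have "card C = dim (UNIV :: 'a set)" using dim_eq_card[of C UNIV] by simp
  then have "C = S"
    using C(1) assms(2,3) by (metis card_ge_0_finite card_subset_eq)
  with C show ?thesis by simp
qed

lemma representation_expand:
  assumes "finite B" "independent B" "span B = UNIV" "linear (g :: 'a::real_vector \<Rightarrow> real)"
  shows "g y = (\<Sum>b\<in>B. representation B y b * g b)"
proof -
  have "g y = g (\<Sum>b\<in>B. representation B y b *\<^sub>R b)"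
    using assms by (simp add: real_vector.sum_representation_eq)
  then show ?thesis using assms(4) by (simp add: linear_sum linear_scale)
qed

lemma linear_representation:
  assumes "independent B" "span B = UNIV"
  shows "linear (\<lambda>y. representation B y b)"
  using assms by (simp add: linear_iff real_vector.representation_add real_vector.representation_scale)

text \<open>The change of basis from \<open>B\<close> to the fixed basis and the change back cancel after the two
  summations are exchanged; the trace can thus be computed in an adapted basis.\<close>

lemma endo_trace_basis:
  assumes lin: "linear f" and B: "finite B" "independent B" "span B = UNIV"
  shows "endo_trace f = (\<Sum>b\<in>B. representation B (f b) b)"
proof -
  let ?A = "set (some_basis :: 'a list)"
  obtain e where "set e = B" "distinct e" using B(1) finite_distinct_list by blast
  with B have "ordered_basis e" by (simp add: ordered_basis_def)
  then have "ordered_basis (some_basis :: 'a list)" unfolding some_basis_def by (rule someI)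
  then have A: "finite ?A" "independent ?A" "span ?A = UNIV" by (auto simp: ordered_basis_def)
  note rep = linear_representation[OF A(2,3)]
  have change: "(\<Sum>a\<in>?A. representation ?A d a * representation B a c) = representation B d c" for c d
    by (rule representation_expand[OF A linear_representation[OF B(2,3)], symmetric])
  have "endo_trace f = (\<Sum>a\<in>?A. \<Sum>c\<in>B. representation B a c * representation ?A (f c) a)"
    unfolding endo_trace_def
    by (intro sum.cong refl representation_expand B linear_compose[OF lin rep, unfolded o_def])
  also have "\<dots> = (\<Sum>a\<in>?A. \<Sum>c\<in>B. \<Sum>d\<in>B.
      representation B (f c) d * (representation ?A d a * representation B a c))"
    by (intro sum.cong refl, subst representation_expand[OF B rep])
      (simp add: sum_distrib_left mult_ac)
  also have "\<dots> = (\<Sum>c\<in>B. \<Sum>d\<in>B. representation B (f c) d *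
      (\<Sum>a\<in>?A. representation ?A d a * representation B a c))"
    by (subst sum.swap, rule sum.cong[OF refl], subst sum.swap) (simp add: sum_distrib_left)
  also have "\<dots> = (\<Sum>c\<in>B. \<Sum>d\<in>B. representation B (f c) d * representation B d c)"
    by (simp only: change)
  also have "\<dots> = (\<Sum>c\<in>B. representation B (f c) c)"
  proof (rule sum.cong[OF refl])
    fix c assume c: "c \<in> B"
    have "(\<Sum>d\<in>B. representation B (f c) d * representation B d c)
        = (\<Sum>d\<in>B. if c = d then representation B (f c) d else 0)"
      by (rule sum.cong) (auto simp: real_vector.representation_basis[OF B(2)])
    also have "\<dots> = representation B (f c) c" using B(1) c by simp
    finally show "(\<Sum>d\<in>B. representation B (f c) d * representation B d c) = representation B (f c) c" .
  qed
  finally show ?thesis .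
qed

lemma linear_kernel_nontrivial:
  fixes f :: "'a::real_vector \<Rightarrow> 'b::euclidean_space"
  assumes "dim (UNIV :: 'a set) > DIM('b)" "linear f"
  obtains v where "v \<noteq> 0" "f v = 0"
proof -
  obtain S :: "'a set" where S: "finite S" "independent S" "span S = UNIV" "card S = dim (UNIV :: 'a set)"
    using dim_UNIV_pos_basis[where 'a = 'a] assms(1) by auto
  have "\<not> inj f"
  proof
    assume "inj f"
    then have inj: "inj_on f X" for X by (rule inj_on_subset) simp
    have "independent (f ` S)" by (intro linear_independent_injective_image assms(2) S(2) inj)
    then have "card (f ` S) \<le> DIM('b)" using independent_bound[of "f ` S"] by simp
    then show False using S(4) assms(1) by (simp add: card_image[OF inj])
  qed
  then show thesis using that linear_injective_0[OF assms(2)] by blast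
qed

section \<open>Nondegeneracy of a \<open>G\<^sub>2\<close>-structure\<close>

text \<open>Multilinearity without a prescribed degree, so that it passes to wedge products and contractions
  without counting arguments.\<close>

definition multilinear_form :: "('a::real_vector list \<Rightarrow> real) \<Rightarrow> bool" where
  "multilinear_form \<omega> \<longleftrightarrow> (\<forall>us ws. linear (\<lambda>x. \<omega> (us @ x # ws)))"

lemma multilinear_form_contract:
  assumes "multilinear_form \<omega>" shows "multilinear_form (contract v \<omega>)"
  using assms unfolding multilinear_form_def contract_def by (simp flip: append_Cons)

lemma multilinear_form_hat:
  assumes "multilinear_form \<omega>" shows "multilinear_form (hat \<omega>)"
  using assms by (simp add: multilinear_form_def hat_def linear_iff algebra_simps)

text \<open>Only the first argument needs thought: \<open>wedge_Cons\<close> moves the other arguments into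
  contractions of the two factors, which are again multilinear.\<close>

lemma multilinear_form_wedge:
  assumes "multilinear_form \<alpha>" "multilinear_form \<beta>"
  shows "multilinear_form (wedge \<alpha> \<beta>)"
proof -
  have "linear (\<lambda>x. wedge \<alpha> \<beta> (us @ x # ws))" for us ws
    using assms
  proof (induction us arbitrary: \<alpha> \<beta>)
    case Nil
    have c: "contract (x + y) \<omega> = (\<lambda>us. contract x \<omega> us + contract y \<omega> us)"
        "contract (k *\<^sub>R x) \<omega> = (\<lambda>us. k * contract x \<omega> us)"
      if "multilinear_form \<omega>" for \<omega> :: "'a list \<Rightarrow> real" and x y k
    proof -
      have "linear (\<lambda>x. \<omega> (x # vs))" for vs
        using that[unfolded multilinear_form_def, rule_format, of "[]" vs] by simp
      then show "contract (x + y) \<omega> = (\<lambda>us. contract x \<omega> us + contract y \<omega> us)"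
        "contract (k *\<^sub>R x) \<omega> = (\<lambda>us. k * contract x \<omega> us)"
        by (auto simp: contract_def fun_eq_iff linear_iff)
    qed
    have r: "wedge \<alpha> (\<lambda>us. k * \<beta> us) vs = k * wedge \<alpha> \<beta> vs" for k vs and \<alpha> \<beta> :: "'a list \<Rightarrow> real"
      by (simp add: wedge_def sum_distrib_left algebra_simps)
    show ?case
      by (simp add: linear_iff wedge_Cons c[OF Nil(1)] c[OF Nil(2)] wedge_linear r distrib_left)
  next
    case (Cons u us)
    then show ?case
      by (simp add: wedge_Cons linear_compose_add multilinear_form_contract multilinear_form_hat)
  qed
  then show ?thesis unfolding multilinear_form_def by blast
qed

lemma antisym_form_repeated:
  assumes "antisym_form \<omega>" "\<not> distinct vs"
  shows "\<omega> vs = 0"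
proof -
  obtain as bs cs x where vs: "vs = as @ [x] @ bs @ [x] @ cs"
    using not_distinct_decomp[OF assms(2)] by blast
  have "\<omega> (x # x # as @ bs @ cs) = - \<omega> (x # x # as @ bs @ cs)"
    using antisym_formD[OF assms(1), of "[]" x x] by simp
  then have "\<omega> (x # x # as @ bs @ cs) = 0" by simp
  moreover have "\<omega> (x # x # as @ bs @ cs) = (- 1) ^ length (x # as @ bs) * \<omega> (x # as @ bs @ x # cs)"
    using antisym_move_front[OF assms(1), of x "x # as @ bs" cs] by simp
  moreover have "\<omega> (x # as @ bs @ x # cs) = (- 1) ^ length as * \<omega> (as @ x # bs @ x # cs)"
    using antisym_move_front[OF assms(1), of x as "bs @ x # cs"] by simp
  ultimately show ?thesis unfolding vs by simp
qed

text \<open>Replace the arguments by basis vectors one at a time, from right to left.\<close>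

lemma multilinear_form_eq_0:
  assumes ml: "multilinear_form \<omega>" and span: "span C = UNIV"
    and z: "\<And>us. length us = k \<Longrightarrow> set us \<subseteq> C \<Longrightarrow> \<omega> us = 0"
    and len: "length us = k"
  shows "\<omega> us = 0"
proof -
  have "\<omega> (us @ ws) = 0" if "length us + length ws = k" "set ws \<subseteq> C" for us ws
    using that
  proof (induction us arbitrary: ws rule: rev_induct)
    case Nil
    then show ?case using z by simp
  next
    case (snoc x us)
    have "x \<in> span C" by (simp add: span)
    then have "\<omega> (us @ x # ws) = 0"
    proof (rule real_vector.linear_eq_0_on_span[rotated 2])
      show "linear (\<lambda>x. \<omega> (us @ x # ws))" using ml by (simp add: multilinear_form_def)
      show "\<omega> (us @ c # ws) = 0" if "c \<in> C" for c
        using snoc.IH[of "c # ws"] snoc.prems that by simp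
    qed
    then show ?case by simp
  qed
  from this[of us "[]"] len show ?thesis by simp
qed

text \<open>On a list of distinct vectors from a basis of size \<open>k\<close> every basis vector occurs, in particular \<open>x\<close> and
  \<open>y\<close>, and these two can be moved to the front at the cost of a sign.\<close>

lemma top_form_eq_0:
  assumes ml: "multilinear_form \<omega>" and as: "antisym_form \<omega>"
    and C: "span C = UNIV" "card C = k" "finite C" and xy: "x \<in> C" "y \<in> C" "x \<noteq> y"
    and z: "\<And>vs. \<omega> (x # y # vs) = 0" and len: "length us = k"
  shows "\<omega> us = 0"
proof (rule multilinear_form_eq_0[OF ml C(1) _ len])
  fix vs assume vs: "length vs = k" "set vs \<subseteq> C"
  show "\<omega> vs = 0"
  proof (cases "distinct vs")
    case False
    then show ?thesis by (rule antisym_form_repeated[OF as])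
  next
    case True
    with vs C have "set vs = C" by (metis card_subset_eq distinct_card)
    with xy(1) obtain as bs where v1: "vs = as @ x # bs" by (metis split_list)
    have "y \<in> set (as @ bs)" using xy \<open>set vs = C\<close> v1 by auto
    then obtain cs ds where v2: "as @ bs = cs @ y # ds" by (metis split_list)
    have "\<omega> (x # y # cs @ ds) = (- 1) ^ length cs * \<omega> (x # cs @ y # ds)"
      using antisym_move_front[OF antisym_contract[OF as], of x y cs ds] by (simp add: contract_def)
    also have "\<omega> (x # cs @ y # ds) = (- 1) ^ length as * \<omega> vs"
      using antisym_move_front[OF as, of x as bs] v1 v2 by simp
    finally show ?thesis by (simp add: z)
  qed
qed

text \<open>Feeding \<open>x\<close> into \<open>\<iota>\<^sub>x\<phi> \<and> \<iota>\<^sub>x\<phi> \<and> \<phi>\<close> leaves the cube of \<open>\<iota>\<^sub>x\<phi>\<close>, because \<open>\<iota>\<^sub>x\<iota>\<^sub>x\<phi> = 0\<close>; feeding \<open>y\<close> into that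
  cube gives zero. A seven-form on a seven-dimensional space annihilated by two independent vectors
  is zero.\<close>

lemma b_form_degenerate:
  assumes phi: "is_form 3 \<phi>" and dim: "dim (UNIV :: 'a::real_vector set) = 7"
    and x: "x \<noteq> 0" and y: "(y::'a) \<notin> span {x}" and z: "\<And>z. \<phi> [x, y, z] = 0"
    and us: "length us = 7"
  shows "b_form \<phi> x x us = 0"
proof -
  let ?A = "contract x \<phi>"
  have as: "antisym_form \<phi>" by (rule is_form_antisym[OF phi])
  have ml: "multilinear_form \<phi>" using phi by (simp add: is_form_def multilinear_form_def)
  have len: "\<phi> vs = 0" if "length vs \<noteq> 3" for vs using phi that by (simp add: is_form_def)
  have xy0: "contract y ?A = (\<lambda>_. 0)"
  proof
    fix vs
    show "contract y ?A vs = 0"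
      by (cases "length vs = 1") (auto simp: contract_def length_Suc_conv z len)
  qed
  have xx0: "contract x ?A = (\<lambda>_. 0)"
    by (rule ext) (simp add: contract_def antisym_form_repeated[OF as])
  have w0: "wedge (\<lambda>_. 0) \<beta> = (\<lambda>_. 0)" "wedge \<beta> (\<lambda>_. 0) = (\<lambda>_. 0)" "hat (\<lambda>_. 0) = (\<lambda>_. 0)"
    for \<beta> :: "'a list \<Rightarrow> real" by (simp_all add: wedge_def hat_def)
  have cw: "contract v (wedge ?A ?A) = (\<lambda>_. 0)" if "contract v ?A = (\<lambda>_. 0)" for v
    by (rule ext) (simp add: contract_def[of v "wedge ?A ?A"] wedge_Cons that w0)
  have zero: "wedge (wedge ?A ?A) \<phi> (x # y # vs) = 0" for vs
    using cw[OF xx0] cw[OF xy0] by (simp add: wedge_Cons contract_simps w0 xy0)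
  obtain C where C: "{x, y} \<subseteq> C" "independent C" "span C = UNIV"
  proof (rule real_vector.maximal_independent_subset_extend[of "{x, y}" UNIV])
    show "independent {x, y}"
      using x y real_vector.independent_insertI[of y "{x}"] by (simp add: insert_commute)
  qed auto
  then have card: "card C = 7" using dim dim_eq_card[of C UNIV] by simp
  then have "finite C" by (intro card_ge_0_finite) simp
  have "wedge (wedge ?A ?A) \<phi> us = 0"
  proof (rule top_form_eq_0[where x = x and y = y, OF _ _ C(3) card \<open>finite C\<close> _ _ _ _ us])
    show "x \<noteq> y" using y by (auto simp: span_base)
    show "wedge (wedge ?A ?A) \<phi> (x # y # vs) = 0" for vs by (rule zero)
  qed (use C in \<open>auto intro!: multilinear_form_wedge multilinear_form_contract ml
      wedge_antisym antisym_contract as\<close>)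
  then show ?thesis by (simp add: b_form_def)
qed

lemma G2_structure_nondegenerate:
  assumes G2: "G2_structure \<phi>" and dim: "dim (UNIV :: 'a::real_vector set) = 7"
    and x: "x \<noteq> 0" and z: "\<And>z. \<phi> [x, y, z] = 0"
  shows "(y::'a) \<in> span {x}"
proof (rule ccontr)
  assume y: "y \<notin> span {x}"
  have "length (some_basis :: 'a list) = 7" using some_basis_ordered_basis(2) dim by (metis zero_less_numeral)
  then have "b_form \<phi> x x some_basis = 0"
    using G2 dim x y z by (intro b_form_degenerate) (auto simp: G2_structure_def stable_form_def)
  then have "g_metric \<phi> x x = 0" by (simp add: g_metric_def)
  with G2 x show False by (auto simp: G2_structure_def)
qed

section \<open>Solvable Lie algebras with three-dimensional derived algebra\<close>

context lie_algebra
begin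

lemmas br_simps =
  bilinear_ladd[OF bracket_bilinear] bilinear_radd[OF bracket_bilinear]
  bilinear_lmul[OF bracket_bilinear] bilinear_rmul[OF bracket_bilinear]
  bilinear_lzero[OF bracket_bilinear] bilinear_rzero[OF bracket_bilinear]

lemma br_skew: "br x y = - br y x"
proof -
  have "br (x + y) (x + y) = br x x + br y x + (br x y + br y y)" by (simp only: br_simps)
  then have "br x y + br y x = 0" by (simp add: bracket_self add.commute)
  then show ?thesis by (rule eq_neg_iff_add_eq_0[THEN iffD2])
qed

lemma linear_br: "linear (br x)" "linear (\<lambda>x. br x y)"
  using bracket_bilinear by (auto simp: bilinear_def)

lemma br_derivation: "br x (br y z) = br (br x y) z + br y (br x z)"
proof -
  have "br y (br z x) = - br y (br x z)"
    using br_skew[of z x] bilinear_rneg[OF bracket_bilinear] by metis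
  moreover have "br z (br x y) = - br (br x y) z" by (rule br_skew)
  ultimately show ?thesis using jacobi[of x y z] by (simp add: algebra_simps add_eq_0_iff)
qed

lemma subspace_derived_series: "subspace (derived_series br k)"
  by (cases k) simp_all

lemma br_in_derived_series:
  "x \<in> derived_series br k \<Longrightarrow> y \<in> derived_series br k \<Longrightarrow> br x y \<in> derived_series br (Suc k)"
  by (auto intro: span_base)

lemma derived_series_ideal: "z \<in> derived_series br k \<Longrightarrow> br y z \<in> derived_series br k"
proof (induction k arbitrary: z)
  case (Suc k)
  let ?S = "{br x y |x y. x \<in> derived_series br k \<and> y \<in> derived_series br k}"
  have "z \<in> span ?S" using Suc.prems by simp
  then show ?case
  proof (induction rule: span_induct)
    case base
    show ?case
      using linear_subspace_vimage[OF linear_br(1) subspace_derived_series[of "Suc k"]]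
      by (simp add: vimage_def)
  next
    case (step z)
    then obtain a b where ab: "z = br a b" "a \<in> derived_series br k" "b \<in> derived_series br k"
      by blast
    then show ?case
      unfolding ab(1) br_derivation[of y a b]
      by (intro subspace_add subspace_derived_series br_in_derived_series Suc.IH)
  qed
qed simp

lemma derived_series_Suc_subset:
  assumes S: "derived_series br k = span S" and T: "subspace T"
    and ST: "\<And>s t. s \<in> S \<Longrightarrow> t \<in> S \<Longrightarrow> br s t \<in> T"
  shows "derived_series br (Suc k) \<subseteq> T"
proof -
  have 1: "br s y \<in> T" if "y \<in> span S" "s \<in> S" for s y
    using that(1)
  proof (induction rule: span_induct)
    case base
    show ?case using linear_subspace_vimage[OF linear_br(1) T] by (simp add: vimage_def)
  qed (use ST that in auto)
  have "br x y \<in> T" if "x \<in> span S" "y \<in> span S" for x y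
    using that(1)
  proof (induction rule: span_induct)
    case base
    show ?case using linear_subspace_vimage[OF linear_br(2) T] by (simp add: vimage_def)
  qed (use 1 that in auto)
  then show ?thesis unfolding derived_series.simps S by (intro span_minimal T) auto
qed

lemma derived_series_decreasing: "derived_series br (Suc k) \<subseteq> derived_series br k"
proof (rule derived_series_Suc_subset[of _ "derived_series br k"])
  show "derived_series br k = span (derived_series br k)"
    using span_eq_iff subspace_derived_series by metis
qed (auto intro: subspace_derived_series derived_series_ideal)

text \<open>If one step of the derived series is an equality, so are all later ones.\<close>

lemma solvable_derived_series_stationary:
  assumes "lie_solvable br" and eq: "derived_series br (Suc k) = derived_series br k"
  shows "derived_series br k = {0}"
proof -
  have "derived_series br k \<subseteq> derived_series br j" for j
  proof (induction j)
    case (Suc j)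
    have "derived_series br (Suc k) \<subseteq> derived_series br (Suc j)"
      unfolding derived_series.simps by (rule span_mono) (use Suc.IH in blast)
    then show ?case by (simp only: eq)
  qed simp
  then show ?thesis
    using assms(1) subspace_0[OF subspace_derived_series[of k]] unfolding lie_solvable_def by blast
qed

text \<open>The action on a one-dimensional ideal is by scalars, which commute, so brackets act by zero.\<close>

lemma line_ideal_centralised:
  assumes "\<And>y. br y x \<in> span {x}" and z: "z \<in> derived_series br (Suc 0)"
  shows "br z x = 0"
proof -
  have "\<exists>c. br y x = c *\<^sub>R x" for y using assms(1)[of y] by (auto simp: span_singleton)
  then obtain c where c: "\<And>y. br y x = c y *\<^sub>R x" by metis
  have "z \<in> span {br a b |a b. a \<in> UNIV \<and> b \<in> UNIV}" using z by simp
  then show ?thesis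
  proof (induction rule: span_induct)
    case base
    show ?case using linear_subspace_kernel[OF linear_br(2)] by simp
  next
    case (step z)
    then obtain a b where "z = br a b" by blast
    then show ?case using br_derivation[of a b x] by (simp add: c br_simps mult.commute)
  qed
qed

text \<open>Let \<open>n\<close> be the derived algebra and distinguish the dimension of \<open>m = [n,n]\<close>, which is less than three by
  solvability. If \<open>m = 0\<close>, any basis will do; if \<open>m\<close> is a line, it is an ideal of the whole algebra, hence
  central in \<open>n\<close>. If \<open>m\<close> were a plane it would be abelian, and for \<open>u\<close> in \<open>n\<close> outside \<open>m\<close> the operator
  \<open>A = ad u\<close> on \<open>m\<close> would be invertible. Modulo \<open>m\<close> the derivation \<open>D = ad v\<close> multiplies \<open>u\<close> by some
  \<open>k \<noteq> 0\<close>, so \<open>DA - AD = kA\<close> on \<open>m\<close>. Then \<open>D\<close> and \<open>D + k\<close> are conjugate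
  by \<open>A\<close>, although their traces differ.\<close>

lemma derived_algebra_basis:
  assumes N: "independent N" "card N = 3" "derived_series br (Suc 0) = span N"
    and solv: "lie_solvable br"
    and surj: "\<And>y. y \<in> span N \<Longrightarrow> \<exists>z\<in>span N. br v z = y"
  obtains x p q where "independent {x, p, q}" "card {x, p, q} = 3"
    "span {x, p, q} = derived_series br (Suc 0)"
    "br x p = 0" "br x q = 0" "br p q \<in> span {x}"
proof -
  note derived_series.simps(2) [simp del]
  let ?M = "derived_series br (Suc (Suc 0))"
  have MN: "?M \<subseteq> span N" using derived_series_decreasing[of "Suc 0"] N(3) by simp
  have M_ne: "?M \<noteq> span N"
  proof
    assume "?M = span N"
    then have "span N = {0}" using solvable_derived_series_stationary[OF solv] N(3) by metis
    then have "N \<subseteq> {0}" using span_superset by metis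
    then have "card N \<le> 1" using card_mono[of "{0}" N] by simp
    then show False using N(2) by simp
  qed
  have brM: "br y z \<in> ?M" if "y \<in> span N" "z \<in> span N" for y z
    using br_in_derived_series[of y "Suc 0" z] that N(3) by simp
  obtain E where E: "E \<subseteq> ?M" "independent E" "?M \<subseteq> span E"
    using real_vector.maximal_independent_subset by metis
  have spanE: "span E = ?M"
    using E span_minimal[OF E(1) subspace_derived_series] by blast
  obtain F where F: "E \<subseteq> F" "F \<subseteq> span N" "independent F" "span N \<subseteq> span F"
    using real_vector.maximal_independent_subset_extend[of E "span N"] E MN by blast
  have spanF: "span F = span N"
    using F span_minimal[OF F(2)] by auto
  have cardF: "card F = 3" using real_vector.dim_eq_card[OF spanF F(3)] N
    by (simp add: real_vector.dim_eq_card_independent)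
  then have finF: "finite F" by (intro card_ge_0_finite) simp
  have "E \<noteq> F" using spanE spanF M_ne by auto
  then have "card E < 3" using F(1) finF cardF psubset_card_mono[of F E] by auto
  moreover have finE: "finite E" using F(1) finF finite_subset by blast
  ultimately consider "card E = 0" | "card E = 1" | "card E = 2" by linarith
  then show thesis
  proof cases
    case 1
    then have "?M = {0}" using finE spanE by auto
    obtain x p q where "F = {x, p, q}" using cardF by (auto simp: card_3_iff)
    moreover from this have "x \<in> span N" "p \<in> span N" "q \<in> span N" using F(2) by auto
    ultimately show thesis
      using that[of x p q] F(3) cardF spanF N(3) brM \<open>?M = {0}\<close> by (auto simp: span_zero)
  next
    case 2
    then obtain x where x: "E = {x}" by (auto simp: card_1_singleton_iff)
    have "card (F - {x}) = 2" using cardF F(1) x by simp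
    then obtain p q where "F - {x} = {p, q}" by (auto simp: card_2_iff)
    then have Feq: "F = {x, p, q}" using F(1) x by auto
    then have mem: "x \<in> span N" "p \<in> span N" "q \<in> span N" using F(2) by auto
    have "br y x \<in> span {x}" for y
      using derived_series_ideal[of x "Suc (Suc 0)" y] E(1) spanE x by simp
    then have "br z x = 0" if "z \<in> span N" for z
      using line_ideal_centralised that N(3) by simp
    then have "br x z = 0" if "z \<in> span N" for z
      using that br_skew[of x z] by simp
    then show thesis
      using that[of x p q] F(3) cardF spanF N(3) brM[OF mem(2,3)] mem spanE x Feq by auto
  next
    case 3
    then obtain p q where pq: "E = {p, q}" "p \<noteq> q" by (auto simp: card_2_iff)
    have indep: "independent {p, q}" using E(2) pq by simp
    have Mpq: "?M = span {p, q}" using spanE pq by simp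
    have mem: "p \<in> ?M" "q \<in> ?M" using E(1) pq by auto
    have "card (F - E) = 1" using cardF F(1) 3 finE by (simp add: card_Diff_subset)
    then obtain u where "F - E = {u}" by (auto simp: card_1_singleton_iff)
    then have Feq: "F = {u, p, q}" using F(1) pq by auto
    then have uN: "u \<in> span N" using F(2) by auto
    have pqN: "p \<in> span N" "q \<in> span N" using mem MN by auto
    \<comment> \<open>Otherwise \<open>[m,m]\<close> is a line and an ideal, hence central in \<open>n\<close>; but in a nonabelian plane the
      derived line is not central.\<close>
    have comm: "br p q = 0"
    proof (rule ccontr)
      assume nz: "br p q \<noteq> 0"
      let ?L = "derived_series br (Suc (Suc (Suc 0)))"
      have sub: "?L \<subseteq> span {br p q}"
        by (rule derived_series_Suc_subset[OF Mpq])
          (auto simp: bracket_self br_skew[of q p] span_zero span_base span_neg)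
      have "br y (br p q) \<in> span {br p q}" for y
        using sub derived_series_ideal[OF br_in_derived_series[OF mem], of y] by blast
      then have k: "br z (br p q) = 0" if "z \<in> span N" for z
        using that N(3) by (intro line_ideal_centralised) auto
      have "br p q \<in> ?M" using brM pqN by blast
      then obtain a b where ab: "br p q = a *\<^sub>R p + b *\<^sub>R q" unfolding Mpq in_span_2 by blast
      have "b *\<^sub>R br p q = 0"
        using arg_cong[OF ab, of "br p"] k[OF pqN(1)] by (simp add: br_simps bracket_self)
      moreover have "a *\<^sub>R br p q = 0"
        using arg_cong[OF ab, of "br q"] k[OF pqN(2)] by (simp add: br_simps bracket_self br_skew[of q p])
      ultimately show False using nz ab by auto
    qed
    \<comment> \<open>Since \<open>m\<close> is abelian, the brackets of \<open>n\<close> are spanned by those with \<open>u\<close>: \<open>ad u\<close> maps \<open>m\<close> onto \<open>m\<close>.\<close>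
    have "?M \<subseteq> span {br u p, br u q}"
    proof (rule derived_series_Suc_subset[of _ F])
      show "derived_series br (Suc 0) = span F" using spanF N(3) by simp
      show "br s t \<in> span {br u p, br u q}" if "s \<in> F" "t \<in> F" for s t
        using that unfolding Feq
        by (auto simp: bracket_self comm br_skew[of q p] br_skew[of p u] br_skew[of q u]
            span_zero span_base span_neg)
    qed simp
    then have "p \<in> span {br u p, br u q}" "q \<in> span {br u p, br u q}"
      using mem by auto
    then obtain s t s' t' where st: "p = s *\<^sub>R br u p + t *\<^sub>R br u q"
        "q = s' *\<^sub>R br u p + t' *\<^sub>R br u q"
      unfolding in_span_2 by blast
    obtain a b where ab: "br u p = a *\<^sub>R p + b *\<^sub>R q"
      using brM[OF uN pqN(1)] unfolding Mpq in_span_2 by blast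
    obtain c d where cd: "br u q = c *\<^sub>R p + d *\<^sub>R q"
      using brM[OF uN pqN(2)] unfolding Mpq in_span_2 by blast
    obtain e f where ef: "br v p = e *\<^sub>R p + f *\<^sub>R q"
      using derived_series_ideal[OF mem(1)] unfolding Mpq in_span_2 by blast
    obtain g h where gh: "br v q = g *\<^sub>R p + h *\<^sub>R q"
      using derived_series_ideal[OF mem(2)] unfolding Mpq in_span_2 by blast
    have "br v u \<in> span {u, p, q}"
      using derived_series_ideal[of u "Suc 0" v] uN N(3) spanF Feq by simp
    then obtain k l m where klm: "br v u = k *\<^sub>R u + l *\<^sub>R p + m *\<^sub>R q"
      unfolding in_span_3 by blast
    \<comment> \<open>If \<open>k\<close> vanished, \<open>ad v\<close> would map \<open>n\<close> into \<open>m\<close>, but it is onto \<open>n\<close>.\<close>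
    have "k \<noteq> 0"
    proof
      assume "k = 0"
      have "br v z \<in> ?M" if "z \<in> span N" for z
      proof -
        have "z \<in> span {u, p, q}" using that spanF Feq by simp
        then obtain a1 a2 a3 where "z = a1 *\<^sub>R u + a2 *\<^sub>R p + a3 *\<^sub>R q" unfolding in_span_3 by blast
        moreover have "br v u \<in> ?M"
          unfolding klm Mpq using \<open>k = 0\<close> by (auto simp: in_span_2)
        ultimately show ?thesis
          using derived_series_ideal[OF mem(1), of v] derived_series_ideal[OF mem(2), of v]
            subspace_derived_series[of "Suc (Suc 0)"]
          by (simp only: br_simps) (intro subspace_add subspace_scale, auto)
      qed
      then have "span N \<subseteq> ?M" using surj by fastforce
      then show False using MN M_ne by blast
    qed
    have "br v (br u p) = br (br v u) p + br u (br v p)" "br v (br u q) = br (br v u) q + br u (br v q)"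
      by (rule br_derivation)+
    then have eqs: "(a * e + b * g) *\<^sub>R p + (a * f + b * h) *\<^sub>R q
        = (k * a + e * a + f * c) *\<^sub>R p + (k * b + e * b + f * d) *\<^sub>R q"
      "(c * e + d * g) *\<^sub>R p + (c * f + d * h) *\<^sub>R q
        = (k * c + g * a + h * c) *\<^sub>R p + (k * d + g * b + h * d) *\<^sub>R q"
      by (simp_all add: klm ab cd ef gh br_simps bracket_self comm br_skew[of q p] algebra_simps)
    have "1 *\<^sub>R p + 0 *\<^sub>R q = (s * a + t * c) *\<^sub>R p + (s * b + t * d) *\<^sub>R q"
      "0 *\<^sub>R p + 1 *\<^sub>R q = (s' * a + t' * c) *\<^sub>R p + (s' * b + t' * d) *\<^sub>R q"
      using st by (simp_all add: ab cd algebra_simps)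
    note coeffs = this[THEN independent_2_coeffs[OF indep pq(2)]] eqs[THEN independent_2_coeffs[OF indep pq(2)]]
    note co = coeffs[THEN conjunct1] coeffs[THEN conjunct2]
    \<comment> \<open>The matrix form of \<open>DA - AD = kA\<close> yields that the trace of \<open>A\<close> (that is, \<open>a + d\<close>) and the trace of its
      square both vanish, whence \<open>det A = 0\<close>. The coefficients \<open>s\<close>, \<open>t\<close>, \<open>s'\<close>, \<open>t'\<close> form a right inverse of \<open>A\<close>.\<close>
    have bg: "b * g = k * a + c * f" and cf: "c * f = k * d + b * g"
      using co(3,8) by (simp_all add: mult.commute)
    then have "k * (a + d) = 0" by (simp add: distrib_left)
    then have d: "d = - a" using \<open>k \<noteq> 0\<close> by simp
    have kb: "k * b = 2 * a * f + b * (h - e)" and kc: "k * c = c * (e - h) - 2 * a * g"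
      using co(4,7) by (simp_all add: d algebra_simps)
    have "2 * k * (b * c) = c * (k * b) + b * (k * c)" by simp
    also have "\<dots> = c * (2 * a * f + b * (h - e)) + b * (c * (e - h) - 2 * a * g)"
      by (simp only: kb kc)
    also have "\<dots> = 2 * a * (c * f - b * g)" by (simp add: algebra_simps)
    also have "c * f - b * g = - (k * a)" using bg by simp
    finally have "2 * k * (b * c) = 2 * k * (- (a * a))" by simp
    then have "b * c = - (a * a)"
      using \<open>k \<noteq> 0\<close> by (simp only: mult_cancel_left) simp
    then have det: "a * d - b * c = 0" unfolding d by simp
    have "(a * d - b * c) * (s * t' - t * s')
        = (s * a + t * c) * (s' * b + t' * d) - (s' * a + t' * c) * (s * b + t * d)"
      by (simp add: algebra_simps)
    also have "\<dots> = 1" unfolding co(1,2,5,6)[symmetric] by simp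
    finally have "(a * d - b * c) * (s * t' - t * s') = 1" .
    with det show thesis by simp
  qed
qed

text \<open>The adjoint operators of \<open>x\<close>, \<open>p\<close> and \<open>q\<close> have zero diagonal in the basis \<open>v\<close>, \<open>x\<close>, \<open>p\<close>, \<open>q\<close>, so
  unimodularity is decided by \<open>ad v\<close> alone.\<close>

lemma unimodular_if_ad_trace_zero:
  assumes B: "independent {v, x, p, q}" "card {v, x, p, q} = 4" "span {v, x, p, q} = UNIV"
    and br: "br x p = 0" "br x q = 0" "br p q = t *\<^sub>R x"
    and v: "br v x = a1 *\<^sub>R x + a2 *\<^sub>R p + a3 *\<^sub>R q" "br v p = b1 *\<^sub>R x + b2 *\<^sub>R p + b3 *\<^sub>R q"
      "br v q = c1 *\<^sub>R x + c2 *\<^sub>R p + c3 *\<^sub>R q"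
    and tr: "a1 + b2 + c3 = 0"
  shows "lie_unimodular br"
proof -
  let ?B = "{v, x, p, q}"
  have dist: "v \<noteq> x" "v \<noteq> p" "v \<noteq> q" "x \<noteq> p" "x \<noteq> q" "p \<noteq> q"
    using B(2) by (auto simp: card_insert_if split: if_splits)
  note lin = linear_representation[OF B(1,3)]
  have rep: "representation ?B (y + z) b = representation ?B y b + representation ?B z b"
    "representation ?B (k *\<^sub>R y) b = k * representation ?B y b"
    "representation ?B (y - z) b = representation ?B y b - representation ?B z b"
    "representation ?B (- y) b = - representation ?B y b"
    "representation ?B 0 b = 0" for y z b k
    using linear_add[OF lin] linear_scale[OF lin] linear_diff[OF lin] linear_neg[OF lin]
      linear_0[OF lin] by auto
  have rb: "representation ?B y b = (if b = y then 1 else 0)" if "y \<in> ?B" for y b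
    using real_vector.representation_basis[OF B(1) that] by simp
  have "br x v = - br v x" "br p v = - br v p" "br q v = - br v q" "br p x = 0" "br q x = 0"
      "br q p = - (t *\<^sub>R x)"
    using br_skew[of x v] br_skew[of p v] br_skew[of q v] br_skew[of p x] br_skew[of q x] br_skew[of q p] br
    by simp_all
  note brs = this br v bracket_self
  have et: "endo_trace (br u) = (\<Sum>b\<in>?B. representation ?B (br u b) b)" for u
    by (rule endo_trace_basis[OF linear_br(1) _ B(1,3)]) simp
  have "linear (\<lambda>u. endo_trace (br u))"
    unfolding et by (intro linear_compose_sum ballI linear_compose[OF linear_br(2) lin, unfolded o_def])
  moreover have "endo_trace (br u) = 0" if "u \<in> ?B" for u
    using that dist dist[symmetric] tr unfolding et
    by (auto simp: brs rep rb)
  ultimately have "endo_trace (br u) = 0" if "u \<in> span ?B" for u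
    using that by (rule real_vector.linear_eq_0_on_span)
  then show ?thesis by (simp add: lie_unimodular_def B(3))
qed

text \<open>A linear right inverse \<open>h\<close> of \<open>z \<mapsto> B[v,z]\<close> gives a section \<open>c \<mapsto> [v, h c]\<close> of \<open>B\<close>, whose image is a
  three-dimensional complement of \<open>v\<close> consisting of brackets. If the derived algebra were larger it
  would be everything, contradicting solvability.\<close>

lemma splitting_derived_algebra:
  fixes B :: "'a \<Rightarrow> real^3"
  assumes dim: "dim (UNIV :: 'a set) = 4" and solv: "lie_solvable br"
    and B: "linear B" and v: "v \<noteq> 0" "B v = 0" and surj: "surj (\<lambda>z. B (br v z))"
  obtains x p q where "independent {v, x, p, q}" "card {v, x, p, q} = 4" "span {v, x, p, q} = UNIV"
    "span {x, p, q} = derived_series br (Suc 0)"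
    "br x p = 0" "br x q = 0" "br p q \<in> span {x}"
proof -
  have "linear (\<lambda>z. B (br v z))" by (rule linear_compose[OF linear_br(1) B, unfolded o_def])
  then obtain h where h: "linear h" "\<And>c. B (br v (h c)) = c"
    using real_vector.linear_surjective_right_inverse[OF _ surj] by (auto simp: fun_eq_iff)
  define g where "g c = br v (h c)" for c
  have lin: "linear g"
    unfolding g_def by (rule linear_compose[OF h(1) linear_br(1), unfolded o_def])
  have inj: "inj_on g X" for X
    by (rule inj_on_inverseI[where g = B]) (simp add: g_def h)
  define N where "N = g ` Basis"
  have indN: "independent N"
    unfolding N_def by (intro linear_independent_injective_image lin independent_Basis inj)
  have cardN: "card N = 3" by (simp add: N_def card_image[OF inj])
  then have finN: "finite N" by (intro card_ge_0_finite) simp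
  have spanN: "span N = range g" by (simp add: N_def linear_span_image[OF lin])
  have vN: "v \<notin> span N"
  proof
    assume "v \<in> span N"
    then obtain c where c: "v = g c" by (auto simp: spanN)
    then have "c = 0" using h(2)[of c] v(2) by (simp add: g_def)
    then show False using v(1) c linear_0[OF lin] by simp
  qed
  have "independent (insert v N)" using vN indN by (rule real_vector.independent_insertI)
  moreover have "card (insert v N) = 4"
    using vN cardN finN by (subst card_insert_disjoint) (auto intro: span_base)
  ultimately have spanvN: "span (insert v N) = UNIV"
    using dim by (intro independent_card_dim_spans) auto
  have sub: "span N \<subseteq> derived_series br (Suc 0)"
    by (auto simp: spanN g_def intro!: span_base)
  have "derived_series br (Suc 0) \<subseteq> span N"
  proof (rule ccontr)
    assume "\<not> derived_series br (Suc 0) \<subseteq> span N"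
    then obtain y where y: "y \<in> derived_series br (Suc 0)" "y \<notin> span N" by blast
    have "y \<in> span (insert v N)" by (simp add: spanvN)
    then obtain k where k: "y - k *\<^sub>R v \<in> span N" unfolding span_breakdown_eq by blast
    have "k \<noteq> 0" using k y(2) by auto
    have "y - (y - k *\<^sub>R v) \<in> derived_series br (Suc 0)"
      using subspace_diff[OF subspace_derived_series y(1)] k sub by blast
    then have "k *\<^sub>R v \<in> derived_series br (Suc 0)"
      by (simp only: diff_diff_eq2 add_diff_cancel_left')
    then have "(1 / k) *\<^sub>R (k *\<^sub>R v) \<in> derived_series br (Suc 0)"
      by (rule subspace_scale[OF subspace_derived_series])
    then have "v \<in> derived_series br (Suc 0)" using \<open>k \<noteq> 0\<close> by simp
    then have "insert v N \<subseteq> derived_series br (Suc 0)"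
      using sub span_superset[of N] by auto
    then have "derived_series br (Suc 0) = UNIV"
      using span_minimal[OF _ subspace_derived_series] spanvN by blast
    then have "(UNIV :: 'a set) = {0}"
      using solvable_derived_series_stationary[OF solv, of 0] by simp
    then show False using v(1) by blast
  qed
  with sub have der: "derived_series br (Suc 0) = span N" by blast
  have surjN: "\<exists>z\<in>span N. br v z = y" if "y \<in> span N" for y
  proof -
    obtain c where c: "y = br v (h c)" using \<open>y \<in> span N\<close> by (auto simp: spanN g_def)
    have "h c \<in> span (insert v N)" by (simp add: spanvN)
    then obtain k where k: "h c - k *\<^sub>R v \<in> span N" unfolding span_breakdown_eq by blast
    moreover have "br v (h c - k *\<^sub>R v) = y"
      by (simp add: c linear_diff[OF linear_br(1)] linear_scale[OF linear_br(1)] bracket_self)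
    ultimately show ?thesis by blast
  qed
  obtain x p q where xpq: "independent {x, p, q}" "card {x, p, q} = 3"
    "span {x, p, q} = derived_series br (Suc 0)" "br x p = 0" "br x q = 0" "br p q \<in> span {x}"
    by (rule derived_algebra_basis[where v = v, OF indN cardN der solv surjN];
        (assumption | (rule that; assumption)))
  have v': "v \<notin> span {x, p, q}" unfolding xpq(3) der by (rule vN)
  then have ind: "independent {v, x, p, q}" using xpq(1) by (rule real_vector.independent_insertI)
  have "v \<notin> {x, p, q}" using v' span_base[of v "{x, p, q}"] by metis
  then have card: "card {v, x, p, q} = 4" using xpq(2) by (subst card_insert_disjoint) auto
  have "span {v, x, p, q} = UNIV"
    by (rule independent_card_dim_spans[OF ind]) (use card dim in linarith)+
  then show thesis using that[OF ind card _ xpq(3-6)] by blast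
qed

end

section \<open>The Lie algebra \<open>sl(2)\<close>\<close>

lemma sl2_standard_triple:
  obtains h e f :: sl2 where
    "sl2_bracket e f = h" "sl2_bracket h e = 2 *\<^sub>R e" "sl2_bracket h f = - (2 *\<^sub>R f)"
    "\<And>z. \<exists>a b c. z = a *\<^sub>R h + b *\<^sub>R e + c *\<^sub>R f"
    "\<And>a b c. a *\<^sub>R h + b *\<^sub>R e + c *\<^sub>R f = 0 \<Longrightarrow> a = 0 \<and> b = 0 \<and> c = 0"
proof -
  define m :: "real \<Rightarrow> real \<Rightarrow> real \<Rightarrow> real^2^2"
    where "m a b c = (\<chi> i j. if i = 1 then if j = 1 then a else b else if j = 1 then c else - a)" for a b c
  have m: "m a b c $ 1 $ 1 = a" "m a b c $ 1 $ 2 = b" "m a b c $ 2 $ 1 = c" "m a b c $ 2 $ 2 = - a"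
    for a b c by (simp_all add: m_def)
  have tr: "m a b c \<in> {A. trace A = 0}" for a b c
    by (simp add: trace_def sum_2 m)
  have rep: "Rep_sl2 (Abs_sl2 (m a b c)) = m a b c" for a b c
    using tr by (rule Abs_sl2_inverse)
  note ent = Rep_sl2_inject[symmetric] zero_sl2.rep_eq plus_sl2.rep_eq uminus_sl2.rep_eq
    scaleR_sl2.rep_eq sl2_bracket.rep_eq rep Finite_Cartesian_Product.vec_eq_iff forall_2 matrix_matrix_mult_def sum_2 m
  show thesis
  proof (rule that[of "Abs_sl2 (m 0 1 0)" "Abs_sl2 (m 0 0 1)" "Abs_sl2 (m 1 0 0)"])
    show "\<exists>a b c. z = a *\<^sub>R Abs_sl2 (m 1 0 0) + b *\<^sub>R Abs_sl2 (m 0 1 0) + c *\<^sub>R Abs_sl2 (m 0 0 1)" for z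
    proof (intro exI)
      have "trace (Rep_sl2 z) = 0" using Rep_sl2[of z] by simp
      then show "z = (Rep_sl2 z $ 1 $ 1) *\<^sub>R Abs_sl2 (m 1 0 0) + (Rep_sl2 z $ 1 $ 2) *\<^sub>R Abs_sl2 (m 0 1 0)
          + (Rep_sl2 z $ 2 $ 1) *\<^sub>R Abs_sl2 (m 0 0 1)"
        by (simp add: ent trace_def)
    qed
  qed (simp_all add: ent)
qed

lemma dim_sl2: "dim (UNIV :: sl2 set) = 3"
proof -
  obtain h e f :: sl2 where ex: "\<And>z. \<exists>a b c. z = a *\<^sub>R h + b *\<^sub>R e + c *\<^sub>R f"
    and z: "\<And>a b c. a *\<^sub>R h + b *\<^sub>R e + c *\<^sub>R f = 0 \<Longrightarrow> a = 0 \<and> b = 0 \<and> c = 0"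
    by (rule sl2_standard_triple) blast
  define g :: "real^3 \<Rightarrow> sl2" where "g c = c $ 1 *\<^sub>R h + c $ 2 *\<^sub>R e + c $ 3 *\<^sub>R f" for c
  have lin: "linear g" by (simp add: linear_iff g_def algebra_simps)
  have "inj g"
    unfolding linear_injective_0[OF lin] using z by (auto simp: g_def Finite_Cartesian_Product.vec_eq_iff forall_3)
  then have inj: "inj_on g X" for X by (rule inj_on_subset) simp
  have "surj g"
  proof (rule surjI)
    fix z
    show "g (SOME c. g c = z) = z"
    proof (rule someI_ex)
      obtain a b c where "z = a *\<^sub>R h + b *\<^sub>R e + c *\<^sub>R f" using ex by blast
      then have "g (vector [a, b, c]) = z" by (simp add: g_def)
      then show "\<exists>c. g c = z" ..
    qed
  qed
  then have "span (g ` Basis) = UNIV" by (simp add: linear_span_image[OF lin])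
  moreover have "independent (g ` Basis)"
    by (intro linear_independent_injective_image lin independent_Basis inj)
  moreover have "card (g ` Basis) = 3" by (simp add: card_image[OF inj])
  ultimately show ?thesis using dim_eq_card[of "g ` Basis" UNIV] by simp
qed

section \<open>Closed three-forms on a product\<close>

lemma CE_d_4: "CE_d br \<omega> [a, b, c, d] =
    - \<omega> [br a b, c, d] + \<omega> [br a c, b, d] - \<omega> [br a d, b, c]
    - \<omega> [br b c, a, d] + \<omega> [br b d, a, c] - \<omega> [br c d, a, b]"
  by (simp add: CE_d_def nths_Cons lessThan_Suc)

lemma is_form_3_linear:
  assumes "is_form 3 \<omega>"
  shows "linear (\<lambda>x. \<omega> [x, y, z])" "linear (\<lambda>x. \<omega> [y, x, z])" "linear (\<lambda>x. \<omega> [y, z, x])"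
proof -
  have "linear (\<lambda>x. \<omega> (us @ x # ws))" for us ws using assms by (simp add: is_form_def)
  from this[of "[]" "[y, z]"] this[of "[y]" "[z]"] this[of "[y, z]" "[]"]
  show "linear (\<lambda>x. \<omega> [x, y, z])" "linear (\<lambda>x. \<omega> [y, x, z])" "linear (\<lambda>x. \<omega> [y, z, x])" by simp_all
qed

lemma is_form_3_skew:
  assumes "is_form 3 \<omega>"
  shows "\<omega> [x, y, z] = - \<omega> [y, x, z]" "\<omega> [x, y, z] = - \<omega> [x, z, y]"
    "\<omega> [x, x, z] = 0" "\<omega> [x, y, x] = 0" "\<omega> [x, y, y] = 0"
proof -
  note as = antisym_formD[OF is_form_antisym[OF assms]]
  show "\<omega> [x, y, z] = - \<omega> [y, x, z]" "\<omega> [x, y, z] = - \<omega> [x, z, y]"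
    using as[of "[]" x y "[z]"] as[of "[x]" y z "[]"] by simp_all
  show "\<omega> [x, x, z] = 0" "\<omega> [x, y, x] = 0" "\<omega> [x, y, y] = 0"
    using assms by (auto simp: is_form_def)
qed

text \<open>Of the six terms of \<open>d\<phi>(a,b,c,d)\<close>, the four with mixed brackets vanish.\<close>

lemma closed_form_prod_mixed:
  assumes "lie_algebra br1" "lie_algebra br2" and phi: "is_form 3 \<phi>"
    and closed: "closed_form (prod_bracket br1 br2) \<phi>"
  shows "\<phi> [(br1 a b, 0), (0, c), (0, d)] = - \<phi> [(0, br2 c d), (a, 0), (b, 0)]"
proof -
  note zero = bilinear_lzero[OF lie_algebra.bracket_bilinear] bilinear_rzero[OF lie_algebra.bracket_bilinear]
  have z: "\<phi> [0, y, z] = 0" for y z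
    using linear_0[OF is_form_3_linear(1)[OF phi]] .
  have "CE_d (prod_bracket br1 br2) \<phi> [(a, 0), (b, 0), (0, c), (0, d)] = 0"
    using closed by (simp add: closed_form_def)
  then show ?thesis
    by (simp add: CE_d_4 prod_bracket_def zero[OF assms(1)] zero[OF assms(2)] z flip: zero_prod_def)
qed

text \<open>The terms of \<open>d\<phi>(v,x,p,q)\<close> that contain a bracket with \<open>v\<close> add up to minus the trace of \<open>ad v\<close> on the span
  of \<open>x\<close>, \<open>p\<close>, \<open>q\<close> times \<open>\<phi>(x,p,q)\<close>; the others vanish, the term with \<open>[p,q]\<close> because \<open>x\<close> is repeated.\<close>

lemma closed_form_prod_right:
  assumes "lie_algebra br1" "lie_algebra br2" and phi: "is_form 3 \<phi>"
    and closed: "closed_form (prod_bracket br1 br2) \<phi>"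
    and br: "br2 x p = 0" "br2 x q = 0" "br2 p q = t *\<^sub>R x"
    and v: "br2 v x = a1 *\<^sub>R x + a2 *\<^sub>R p + a3 *\<^sub>R q" "br2 v p = b1 *\<^sub>R x + b2 *\<^sub>R p + b3 *\<^sub>R q"
      "br2 v q = c1 *\<^sub>R x + c2 *\<^sub>R p + c3 *\<^sub>R q"
  shows "(a1 + b2 + c3) * \<phi> [(0, x), (0, p), (0, q)] = 0"
proof -
  note zero = bilinear_lzero[OF lie_algebra.bracket_bilinear]
  have z: "\<phi> [0, y, z] = 0" for y z
    using linear_0[OF is_form_3_linear(1)[OF phi]] .
  have lin: "linear (\<lambda>u. \<phi> [(0, u), y, z])" for y z
    using linear_compose[OF _ is_form_3_linear(1)[OF phi, of y z], of "\<lambda>u. (0, u)"]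
    by (simp add: o_def linear_iff)
  note skew = is_form_3_skew[OF phi]
  have perm: "\<phi> [(0, p), (0, x), (0, q)] = - \<phi> [(0, x), (0, p), (0, q)]"
    "\<phi> [(0, q), (0, x), (0, p)] = \<phi> [(0, x), (0, p), (0, q)]"
    using skew(1)[of "(0, p)" "(0, x)" "(0, q)"] skew(1)[of "(0, q)" "(0, x)" "(0, p)"]
      skew(2)[of "(0, x)" "(0, q)" "(0, p)"] by simp_all
  have "CE_d (prod_bracket br1 br2) \<phi> [(0, v), (0, x), (0, p), (0, q)] = 0"
    using closed by (simp add: closed_form_def)
  then show ?thesis
    by (simp add: CE_d_4 prod_bracket_def zero[OF assms(1)] br v linear_add[OF lin] linear_scale[OF lin]
        skew(3-5) perm z algebra_simps flip: zero_prod_def)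
qed

section \<open>The non-existence theorem\<close>

theorem proposition4p8:
  fixes br :: "'a::real_vector \<Rightarrow> 'a \<Rightarrow> 'a"
  assumes "lie_algebra br"
    and "dim (UNIV :: 'a set) = 4"
    and "lie_solvable br"
    and "lie_center br = {0}"
    and "\<not> lie_unimodular br"
  shows "\<not> (\<exists>\<phi> :: (sl2 \<times> 'a) list \<Rightarrow> real.
            G2_structure \<phi> \<and> closed_form (prod_bracket sl2_bracket br) \<phi>)"
proof
  assume "\<exists>\<phi> :: (sl2 \<times> 'a) list \<Rightarrow> real.
            G2_structure \<phi> \<and> closed_form (prod_bracket sl2_bracket br) \<phi>"
  then obtain \<phi> :: "(sl2 \<times> 'a) list \<Rightarrow> real"
    where G2: "G2_structure \<phi>" and closed: "closed_form (prod_bracket sl2_bracket br) \<phi>" by blast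
  interpret lie_algebra br by fact
  have phi: "is_form 3 \<phi>" using G2 by (simp add: G2_structure_def stable_form_def)
  have "dim (UNIV :: (sl2 \<times> 'a) set) = 7" using assms(2) by (simp add: dim_prod dim_sl2)
  note nondeg = G2_structure_nondegenerate[OF G2 this]
  note mixed = closed_form_prod_mixed[OF lie_algebra_sl2_bracket assms(1) phi closed]
  note skew = is_form_3_skew[OF phi]
  note lin = is_form_3_linear[OF phi]
  have add: "\<phi> [x + x', y, z] = \<phi> [x, y, z] + \<phi> [x', y, z]" "\<phi> [y, x + x', z] = \<phi> [y, x, z] + \<phi> [y, x', z]"
    "\<phi> [y, z, x + x'] = \<phi> [y, z, x] + \<phi> [y, z, x']" for x x' y z
    using linear_add[OF lin(1)] linear_add[OF lin(2)] linear_add[OF lin(3)] by auto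
  have scale: "\<phi> [k *\<^sub>R x, y, z] = k * \<phi> [x, y, z]" "\<phi> [y, k *\<^sub>R x, z] = k * \<phi> [y, x, z]"
    "\<phi> [y, z, k *\<^sub>R x] = k * \<phi> [y, z, x]" for x y z k
    using linear_scale[OF lin(1)] linear_scale[OF lin(2)] linear_scale[OF lin(3)] by auto
  have pair: "(a + b, 0 :: 'a) = (a, 0) + (b, 0)" "(k *\<^sub>R a, 0 :: 'a) = k *\<^sub>R (a, 0)"
    "(0 :: sl2, y + z) = (0, y) + (0, z)" "(0 :: sl2, k *\<^sub>R y) = k *\<^sub>R (0, y)" for a b :: sl2 and y z :: 'a and k
    by simp_all
  obtain h e f :: sl2 where sl2:
    "sl2_bracket e f = h" "sl2_bracket h e = 2 *\<^sub>R e" "sl2_bracket h f = - (2 *\<^sub>R f)"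
    and gen: "\<And>z. \<exists>a b c. z = a *\<^sub>R h + b *\<^sub>R e + c *\<^sub>R f"
    and ind: "\<And>a b c. a *\<^sub>R h + b *\<^sub>R e + c *\<^sub>R f = 0 \<Longrightarrow> a = 0 \<and> b = 0 \<and> c = 0"
    by (rule sl2_standard_triple) blast
  \<comment> \<open>The component of type (1,2) is determined by the one of type (2,1): each basis vector of \<open>sl(2)\<close> is a
    bracket, up to the factors 2 and -2, which explain the halves.\<close>
  have split: "\<phi> [(a *\<^sub>R h + b *\<^sub>R e + c *\<^sub>R f, 0), (0, y), (0, z)]
      = - a * \<phi> [(0, br y z), (e, 0), (f, 0)] - b / 2 * \<phi> [(0, br y z), (h, 0), (e, 0)]
        + c / 2 * \<phi> [(0, br y z), (h, 0), (f, 0)]" for a b c y z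
  proof -
    have "a *\<^sub>R h + b *\<^sub>R e + c *\<^sub>R f
        = a *\<^sub>R sl2_bracket e f + (b / 2) *\<^sub>R sl2_bracket h e + (- c / 2) *\<^sub>R sl2_bracket h f"
      by (simp add: sl2)
    then show ?thesis by (simp only: pair add scale mixed)
  qed
  define B :: "'a \<Rightarrow> real^3" where
    "B y = vector [\<phi> [(0, y), (e, 0), (f, 0)], \<phi> [(0, y), (h, 0), (e, 0)], \<phi> [(0, y), (h, 0), (f, 0)]]" for y
  have B: "linear B"
    by (simp add: linear_iff B_def Finite_Cartesian_Product.vec_eq_iff forall_3 pair(3,4) add scale
        del: add_Pair scaleR_Pair)
  obtain v where v: "v \<noteq> 0" "B v = 0"
    by (rule linear_kernel_nontrivial[OF _ B]) (simp add: assms(2))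
  have vss: "\<phi> [(0, v), (a, 0), (b, 0)] = 0" for a b
  proof -
    have "\<phi> [(0, v), (e, 0), (f, 0)] = 0" "\<phi> [(0, v), (h, 0), (e, 0)] = 0" "\<phi> [(0, v), (h, 0), (f, 0)] = 0"
      using v(2) by (simp_all add: B_def Finite_Cartesian_Product.vec_eq_iff forall_3)
    moreover from this have "\<phi> [(0, v), (f, 0), (e, 0)] = 0" "\<phi> [(0, v), (e, 0), (h, 0)] = 0"
        "\<phi> [(0, v), (f, 0), (h, 0)] = 0"
      using skew(2)[of "(0, v)" "(f, 0)" "(e, 0)"] skew(2)[of "(0, v)" "(e, 0)" "(h, 0)"]
        skew(2)[of "(0, v)" "(f, 0)" "(h, 0)"] by simp_all
    moreover obtain a1 a2 a3 where "a = a1 *\<^sub>R h + a2 *\<^sub>R e + a3 *\<^sub>R f" using gen by blast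
    moreover obtain b1 b2 b3 where "b = b1 *\<^sub>R h + b2 *\<^sub>R e + b3 *\<^sub>R f" using gen by blast
    ultimately show ?thesis by (simp add: pair add scale skew(3-5) del: add_Pair scaleR_Pair)
  qed
  have "span (range (\<lambda>z. B (br v z))) = UNIV"
  proof (rule ccontr)
    assume "span (range (\<lambda>z. B (br v z))) \<noteq> UNIV"
    then obtain c where c: "c \<noteq> 0" and orth: "\<forall>y\<in>span (range (\<lambda>z. B (br v z))). inner c y = 0"
      using span_not_UNIV_orthogonal by auto
    \<comment> \<open>The factors 1, 2, -2 make \<open>y\<close> the combination of \<open>[e,f]\<close>, \<open>[h,e]\<close>, \<open>[h,f]\<close> with coefficients \<open>c\<close>, so
      that \<open>\<phi>(v,y,z)\<close> is the inner product of \<open>c\<close> with \<open>B[v,z]\<close>.\<close>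
    define y where "y = c $ 1 *\<^sub>R h + (2 * c $ 2) *\<^sub>R e + (- 2 * c $ 3) *\<^sub>R f"
    have "\<phi> [(0, v), (y, 0), w] = 0" for w
    proof -
      obtain a z where w: "w = (a, 0) + (0, z)" by (cases w) auto
      have "\<phi> [(0, v), (y, 0), (0, z)] = inner c (B (br v z))"
        unfolding skew(1)[of "(0, v)"] y_def split by (simp add: B_def inner_vec_def sum_3)
      then show ?thesis unfolding w add using orth by (simp add: vss span_base)
    qed
    then have "(y, 0) \<in> span {(0 :: sl2, v)}" using v(1) by (intro nondeg) (auto simp: zero_prod_def)
    then have "y = 0" by (auto simp: span_singleton)
    then have "c = 0" using ind unfolding y_def
      by (fastforce simp: Finite_Cartesian_Product.vec_eq_iff forall_3)
    with c show False ..
  qed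
  moreover have "linear (\<lambda>z. B (br v z))" by (rule linear_compose[OF linear_br(1) B, unfolded o_def])
  ultimately have surj: "surj (\<lambda>z. B (br v z))"
    using linear_subspace_image[of "\<lambda>z. B (br v z)" UNIV] span_eq_iff by (metis subspace_UNIV)
  obtain x p q where xpq: "independent {v, x, p, q}" "card {v, x, p, q} = 4" "span {v, x, p, q} = UNIV"
    and der: "span {x, p, q} = derived_series br (Suc 0)"
    and br: "br x p = 0" "br x q = 0" "br p q \<in> span {x}"
    by (rule splitting_derived_algebra[OF assms(2,3) B v surj]; (rule that; assumption))
  obtain t where t: "br p q = t *\<^sub>R x" using br(3) by (auto simp: span_singleton)
  have ideal: "br v y \<in> span {x, p, q}" if "y \<in> {x, p, q}" for y
    unfolding der by (rule derived_series_ideal) (use that in \<open>simp only: flip: der, simp add: span_base\<close>)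
  obtain a1 a2 a3 where a: "br v x = a1 *\<^sub>R x + a2 *\<^sub>R p + a3 *\<^sub>R q"
    using ideal[of x] unfolding in_span_3 by blast
  obtain b1 b2 b3 where b: "br v p = b1 *\<^sub>R x + b2 *\<^sub>R p + b3 *\<^sub>R q"
    using ideal[of p] unfolding in_span_3 by blast
  obtain c1 c2 c3 where c: "br v q = c1 *\<^sub>R x + c2 *\<^sub>R p + c3 *\<^sub>R q"
    using ideal[of q] unfolding in_span_3 by blast
  have "a1 + b2 + c3 \<noteq> 0"
    using unimodular_if_ad_trace_zero[OF xpq br(1,2) t a b c] assms(5) by blast
  then have xpq0: "\<phi> [(0, x), (0, p), (0, q)] = 0"
    using closed_form_prod_right[OF lie_algebra_sl2_bracket assms(1) phi closed br(1,2) t a b c] by simp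
  \<comment> \<open>One linear condition on the plane spanned by \<open>p\<close> and \<open>q\<close> has a nontrivial solution.\<close>
  obtain r s where rs: "r \<noteq> 0 \<or> s \<noteq> 0"
    "r * \<phi> [(0, x), (0, p), (0, v)] + s * \<phi> [(0, x), (0, q), (0, v)] = 0"
  proof (cases "\<phi> [(0, x), (0, p), (0, v)] = 0")
    case True
    then show ?thesis using that[of 1 0] by simp
  next
    case False
    then show ?thesis
      using that[of "\<phi> [(0, x), (0, q), (0, v)]" "- \<phi> [(0, x), (0, p), (0, v)]"] by simp
  qed
  define y where "y = r *\<^sub>R p + s *\<^sub>R q"
  have "\<phi> [(0, x), (0, y), w] = 0" for w
  proof -
    obtain a z where w: "w = (a, 0) + (0, z)" by (cases w) auto
    have "z \<in> span {v, x, p, q}" by (simp add: xpq(3))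
    then obtain k where "z - k *\<^sub>R v \<in> span {x, p, q}" unfolding span_breakdown_eq[of z v] by blast
    then obtain k1 k2 k3 where "z - k *\<^sub>R v = k1 *\<^sub>R x + k2 *\<^sub>R p + k3 *\<^sub>R q"
      unfolding in_span_3 by blast
    then have z: "z = k *\<^sub>R v + k1 *\<^sub>R x + k2 *\<^sub>R p + k3 *\<^sub>R q" by (simp add: algebra_simps)
    have "\<phi> [(0, x), (0, q), (0, p)] = 0" using xpq0 skew(2)[of "(0, x)" "(0, q)"] by simp
    then have "\<phi> [(0, x), (0, y), (0, z)] = k * (r * \<phi> [(0, x), (0, p), (0, v)] + s * \<phi> [(0, x), (0, q), (0, v)])"
      by (simp add: y_def z pair(3,4) add scale skew(3-5) xpq0 algebra_simps del: add_Pair scaleR_Pair)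
    moreover have "\<phi> [(0, x), (0, y), (a, 0)] = 0"
    proof -
      obtain a1 a2 a3 where a: "a = a1 *\<^sub>R h + a2 *\<^sub>R e + a3 *\<^sub>R f" using gen by blast
      have "br x y = 0" by (simp add: y_def br_simps br)
      then have "(0, br x y) = (0 :: sl2 \<times> 'a)" by (simp add: zero_prod_def)
      then have "\<phi> [(a, 0), (0, x), (0, y)] = 0"
        unfolding a split using linear_0[OF lin(1)] by simp
      then show ?thesis using skew(1,2)[of "(0, x)"] skew(1)[of "(a, 0)"] by metis
    qed
    ultimately show ?thesis unfolding w add by (simp add: rs(2))
  qed
  moreover have "x \<noteq> 0" using xpq(1) real_vector.dependent_zero[of "{v, x, p, q}"] by auto
  ultimately have "(0 :: sl2, y) \<in> span {(0, x)}" by (intro nondeg) (auto simp: zero_prod_def)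
  then obtain k where "y = k *\<^sub>R x" by (auto simp: span_singleton)
  then have y: "r *\<^sub>R p + s *\<^sub>R q = k *\<^sub>R x" by (simp add: y_def)
  let ?B = "{v, x, p, q}"
  have dist: "x \<noteq> p" "x \<noteq> q" "p \<noteq> q"
    using xpq(2) by (auto simp: card_insert_if split: if_splits)
  have coeff: "r * (if b = p then 1 else 0) + s * (if b = q then 1 else 0) = k * (if b = x then 1 else 0)" for b
  proof -
    note lin = linear_representation[OF xpq(1,3), of b]
    have rb: "representation ?B z b = (if b = z then 1 else 0)" if "z \<in> ?B" for z
      using real_vector.representation_basis[OF xpq(1) that] by simp
    show ?thesis
      using arg_cong[OF y, of "\<lambda>z. representation ?B z b"]
      by (simp only: linear_add[OF lin] linear_scale[OF lin] rb insertI1 insertI2 real_scaleR_def)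
  qed
  have "r = 0" "s = 0" using coeff[of p] coeff[of q] dist by auto
  with rs(1) show False by simp
qed

end
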